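(* Let $n\ge3$, $1<d_1<d_2<\infty$ and $1\le r\le\infty$. Then there exists $C>0$ such that $$\|\mathcal{G}_1(\psi)(x',0,t)\|_{L^{(d_2,r)}(\partial\mathbb{R}^n_+,dx')}\le C\,t^{-\left(\frac{n-1}{2d_1}-\frac{n-1}{2d_2}+\frac12\right)}\|\psi\|_{L^{(d_1,r)}(\partial\mathbb{R}^n_+,dx')},$$ $$\|\mathcal{G}_1(\psi)(x,t)\|_{L^{(d_2,r)}(\mathbb{R}^n_+,dx)}\le C\,t^{-\left(\frac{n-1}{2d_1}-\frac{n}{2d_2}+\frac12\right)}\|\psi\|_{L^{(d_1,r)}(\partial\mathbb{R}^n_+,dx')}$$ for all $\psi\in L^{(d_1,r)}(\partial\mathbb{R}^n_+)$ and all $t>0$.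
   Context: $\mathbb{R}^n_+=\{x=(x',x_n): x'\in\mathbb{R}^{n-1},\ x_n>0\}$; $\partial\mathbb{R}^n_+$ is identified with $\mathbb{R}^{n-1}$ with Lebesgue measure $dx'$, and $y'\in\partial\mathbb{R}^n_+$ with $(y',0)$. $\mathcal{G}_1(\psi)(x,t)=\int_{\partial\mathbb{R}^n_+}G(x,y',t)\psi(y')\,dy'$ for $x\in\overline{\mathbb{R}^n_+}$, $t>0$, where, with $y^*=(y',-y_n)$, $G(x,y,t)=(4\pi t)^{-n/2}\left[e^{-|x-y|^2/(4t)}+e^{-|x-y^*|^2/(4t)}\right]$; $\mathcal{G}_1(\psi)(x',0,t)$ is its value at $x=(x',0)$. Lorentz spaces: for measurable $f$ on $\Omega$, $f^*(t)=\inf\{s>0:|\{x\in\Omega:|f(x)|>s\}|\le t\}$, $f^{**}(t)=\frac1t\int_0^tf^*(s)\,ds$; for $1<d<\infty$, $L^{(d,r)}(\Omega)$ is normed by $\|f\|_{L^{(d,r)}(\Omega)}=\left[\int_0^\infty(t^{1/d}f^{**}(t))^r\frac{dt}{t}\right]^{1/r}$ if $1\le r<\infty$ and $\sup_{t>0}t^{1/d}f^{**}(t)$ if $r=\infty$. *)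

theory Defs
  imports "HOL-Analysis.Analysis"
begin

text \<open>
  For a finite index type \<open>'m\<close> with \<open>CARD('m) = n - 1\<close>, the space \<open>R^n = R^(n-1) \<times> R\<close> is
  \<open>(real ^ 'm) \<times> real\<close>, which carries the Euclidean norm and Lebesgue measure; a point is
  \<open>x = (x', x\<^sub>n)\<close>. The boundary of the half-space is identified with \<open>real ^ 'm\<close>.
\<close>

definition half_space :: "((real ^ 'm::finite) \<times> real) set" where
  "half_space = {x. snd x > 0}"

definition reflect :: "(real ^ 'm::finite) \<times> real \<Rightarrow> (real ^ 'm) \<times> real" where
  "reflect y = (fst y, - snd y)"

definition neumann_kernel ::
    "(real ^ 'm::finite) \<times> real \<Rightarrow> (real ^ 'm) \<times> real \<Rightarrow> real \<Rightarrow> real" where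
  "neumann_kernel x y t =
     (4 * pi * t) powr (- real DIM((real ^ 'm) \<times> real) / 2) *
     (exp (- (norm (x - y))\<^sup>2 / (4 * t)) + exp (- (norm (x - reflect y))\<^sup>2 / (4 * t)))"

definition bdry_potential ::
    "(real ^ 'm::finite \<Rightarrow> real) \<Rightarrow> (real ^ 'm) \<times> real \<Rightarrow> real \<Rightarrow> real" where
  "bdry_potential \<psi> x t = (\<integral>y'. neumann_kernel x (y', 0) t * \<psi> y' \<partial>lebesgue)"

text \<open>
  Lorentz quantities are extended nonnegative reals, so the infimum of the empty set and
  divergent integrals are \<open>\<infinity>\<close>. The power below is only used with exponents \<open>p > 0\<close>.
\<close>

definition ennpow :: "ennreal \<Rightarrow> real \<Rightarrow> ennreal" where
  "ennpow a p = (if a = \<infinity> then \<infinity> else ennreal (enn2real a powr p))"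

definition rearr :: "'a::euclidean_space set \<Rightarrow> ('a \<Rightarrow> real) \<Rightarrow> real \<Rightarrow> ennreal" where
  "rearr \<Omega> f t =
     Inf (ennreal ` {s. s > 0 \<and> emeasure lebesgue {x \<in> \<Omega>. \<bar>f x\<bar> > s} \<le> ennreal t})"

definition avg_rearr :: "'a::euclidean_space set \<Rightarrow> ('a \<Rightarrow> real) \<Rightarrow> real \<Rightarrow> ennreal" where
  "avg_rearr \<Omega> f t = ennreal (1 / t) * (\<integral>\<^sup>+s\<in>{0<..<t}. rearr \<Omega> f s \<partial>lborel)"

definition lorentz_norm ::
    "'a::euclidean_space set \<Rightarrow> real \<Rightarrow> ennreal \<Rightarrow> ('a \<Rightarrow> real) \<Rightarrow> ennreal" where
  "lorentz_norm \<Omega> d r f =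
     (if r = \<infinity> then (SUP t\<in>{0<..}. ennreal (t powr (1 / d)) * avg_rearr \<Omega> f t)
      else ennpow
        (\<integral>\<^sup>+t\<in>{0<..}. ennpow (ennreal (t powr (1 / d)) * avg_rearr \<Omega> f t) (enn2real r)
                          * ennreal (1 / t) \<partial>lborel)
        (1 / enn2real r))"

definition lorentz_space ::
    "'a::euclidean_space set \<Rightarrow> real \<Rightarrow> ennreal \<Rightarrow> ('a \<Rightarrow> real) set" where
  "lorentz_space \<Omega> d r =
     {f. f \<in> borel_measurable (lebesgue_on \<Omega>) \<and> lorentz_norm \<Omega> d r f < \<infinity>}"

end

theory Submission
  imports Defs "HOL-Probability.Distributions"
begin

text \<open>
  The maximal function \<open>f**\<close> is a K-functional:
  \<open>s f**(s) = min\<^sub>l (\<integral>(|f| - l)\<^sup>+ + l s)\<close> over \<open>l \<ge> 0\<close>. On the boundary the kernel is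
  a constant multiple of the Gaussian, with integral \<open>c = 2 (4\<pi>t) powr (-1/2)\<close> and supremum
  \<open>c / A\<close>, where \<open>A = (4\<pi>t) powr ((n - 1)/2)\<close>. Splitting \<open>|\<psi>| \<le> (|\<psi>| - l)\<^sup>+ + l\<close>
  under the integral, its \<open>L\<^sup>1\<close> and \<open>L\<^sup>\<infinity>\<close> norms give for \<open>g = G\<^sub>1(\<psi>)\<close> the pointwise bounds
  \<open>g**(k s) \<le> c \<psi>**(s)\<close> and \<open>g**(s) \<le> c \<psi>**(A)\<close>, with \<open>k = 1\<close> on the boundary and
  \<open>k = (4\<pi>t) powr (1/2)\<close>, the mass of the normal Gaussian factor, on the half-space. Using the
  second bound below \<open>A\<close> and the first one above \<open>A\<close> in the Lorentz integral yields both
  estimates, because \<open>d\<^sub>1 < d\<^sub>2\<close>.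
\<close>

section \<open>The decreasing rearrangement and the K-functional\<close>

lemma borel_measurable_antimono_ennreal:
  fixes f :: "real \<Rightarrow> ennreal"
  assumes "antimono f"
  shows "f \<in> borel_measurable borel"
proof (rule borel_measurableI_greater)
  fix y
  have "is_interval {x. y < f x}"
    unfolding is_interval_1
    using assms by (auto simp: antimono_def intro: less_le_trans)
  then show "{x \<in> space borel. y < f x} \<in> sets borel"
    by (simp add: real_interval_borel_measurable)
qed

lemma sets_superlevel:
  fixes f :: "'a::euclidean_space \<Rightarrow> real"
  assumes "\<Omega> \<in> sets lebesgue" and "f \<in> borel_measurable (lebesgue_on \<Omega>)"
  shows "{x \<in> \<Omega>. \<bar>f x\<bar> > s} \<in> sets lebesgue"
proof -
  have "{x \<in> space (lebesgue_on \<Omega>). \<bar>f x\<bar> > s} \<in> sets (lebesgue_on \<Omega>)"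
    using assms(2) by measurable
  then show ?thesis
    using assms(1) by (auto simp: sets_restrict_space_iff space_restrict_space)
qed

lemma antimono_distribution:
  fixes f :: "'a::euclidean_space \<Rightarrow> real"
  assumes "\<Omega> \<in> sets lebesgue" and "f \<in> borel_measurable (lebesgue_on \<Omega>)"
  shows "antimono (\<lambda>s. emeasure lebesgue {x \<in> \<Omega>. \<bar>f x\<bar> > s})"
  by (intro antimonoI emeasure_mono sets_superlevel assms) auto

lemma antimono_rearr: "antimono (rearr \<Omega> f)"
proof (rule antimonoI)
  fix t u :: real
  assume "t \<le> u"
  then have "{s. 0 < s \<and> emeasure lebesgue {x \<in> \<Omega>. \<bar>f x\<bar> > s} \<le> ennreal t} \<subseteq>
      {s. 0 < s \<and> emeasure lebesgue {x \<in> \<Omega>. \<bar>f x\<bar> > s} \<le> ennreal u}"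
    using order_trans[OF _ ennreal_leI[OF \<open>t \<le> u\<close>]] by blast
  then show "rearr \<Omega> f u \<le> rearr \<Omega> f t"
    unfolding rearr_def by (rule Inf_superset_mono[OF image_mono])
qed

lemma borel_measurable_rearr [measurable]: "rearr \<Omega> f \<in> borel_measurable borel"
  by (rule borel_measurable_antimono_ennreal[OF antimono_rearr])

text \<open>The distribution function is antitone, so \<open>?D\<close> is empty or an interval
  starting at \<open>l\<close>, and every level beyond its right end is admissible in the infimum.
  Together with \<open>le_rearr\<close> this presents the part of \<open>rearr\<close> above
  \<open>l\<close> as the length of a set of levels, a form to which Tonelli's theorem
  applies.\<close>

lemma rearr_le:
  fixes f :: "'a::euclidean_space \<Rightarrow> real"
  assumes \<Omega>: "\<Omega> \<in> sets lebesgue" and f: "f \<in> borel_measurable (lebesgue_on \<Omega>)" and l: "0 \<le> l"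
  shows "rearr \<Omega> f u \<le> ennreal l +
    emeasure lborel {s. l < s \<and> ennreal u < emeasure lebesgue {x \<in> \<Omega>. \<bar>f x\<bar> > s}}"
    (is "_ \<le> _ + emeasure lborel ?D")
proof (rule ennreal_le_epsilon)
  fix e :: real
  assume fin: "ennreal l + emeasure lborel ?D < top" and e: "0 < e"
  then obtain d where d: "0 \<le> d" "emeasure lborel ?D = ennreal d"
    by (cases "emeasure lborel ?D" rule: ennreal_cases) auto
  have anti: "antimono (\<lambda>s. emeasure lebesgue {x \<in> \<Omega>. \<bar>f x\<bar> > s})"
    using \<Omega> f by (rule antimono_distribution)
  have "?D \<in> sets borel"
    by (rule real_interval_borel_measurable)
       (use anti in \<open>auto simp: is_interval_1 antimono_def intro: less_le_trans\<close>)
  \<comment> \<open>If \<open>l + d + e\<close> lay in \<open>?D\<close>, a set of measure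
    \<open>d\<close> would contain an interval of length \<open>d + e\<close>; hence
    \<open>l + d + e\<close> is an admissible level.\<close>
  moreover have "{l<..l + d + e} \<subseteq> ?D" if "l + d + e \<in> ?D"
  proof
    fix s assume "s \<in> {l<..l + d + e}"
    then show "s \<in> ?D"
      using that antimonoD[OF anti, of s "l + d + e"] by (auto intro: less_le_trans)
  qed
  ultimately have "l + d + e \<notin> ?D"
    using emeasure_mono[of "{l<..l + d + e}" ?D lborel] d l e
    by (auto simp: ennreal_le_iff)
  then have "emeasure lebesgue {x \<in> \<Omega>. \<bar>f x\<bar> > l + d + e} \<le> ennreal u"
    using d e by (auto simp: not_less)
  then have "rearr \<Omega> f u \<le> ennreal (l + d + e)"
    unfolding rearr_def using l d e by (intro Inf_lower imageI) auto
  then show "rearr \<Omega> f u \<le> ennreal l + emeasure lborel ?D + ennreal e"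
    using l d e by (simp add: ennreal_plus)
qed

text \<open>A level above \<open>rearr \<Omega> f u\<close> has an admissible level below it and is
  then admissible itself, so \<open>?D\<close> ends at \<open>rearr \<Omega> f u\<close>. The left
  side is never below \<open>l\<close>, hence the restriction on \<open>l\<close>.\<close>

lemma le_rearr:
  fixes f :: "'a::euclidean_space \<Rightarrow> real"
  assumes \<Omega>: "\<Omega> \<in> sets lebesgue" and f: "f \<in> borel_measurable (lebesgue_on \<Omega>)"
    and l: "0 \<le> l" "ennreal l \<le> rearr \<Omega> f u"
  shows "ennreal l + emeasure lborel {s. l < s \<and> ennreal u < emeasure lebesgue {x \<in> \<Omega>. \<bar>f x\<bar> > s}}
    \<le> rearr \<Omega> f u"
    (is "_ + emeasure lborel ?D \<le> _")
proof (cases "rearr \<Omega> f u = top")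
  case False
  then obtain r where r: "0 \<le> r" "rearr \<Omega> f u = ennreal r"
    by (metis ennreal_cases)
  have "?D \<subseteq> {l<..r}"
  proof (intro subsetI, rule ccontr)
    fix s assume s: "s \<in> ?D" "s \<notin> {l<..r}"
    then have "rearr \<Omega> f u < ennreal s"
      using r by (auto simp: ennreal_less_iff)
    then obtain s' where s': "s' < s" "emeasure lebesgue {x \<in> \<Omega>. \<bar>f x\<bar> > s'} \<le> ennreal u"
      unfolding rearr_def Inf_less_iff by (auto simp: ennreal_less_iff)
    have "emeasure lebesgue {x \<in> \<Omega>. \<bar>f x\<bar> > s} \<le> emeasure lebesgue {x \<in> \<Omega>. \<bar>f x\<bar> > s'}"
      using antimono_distribution[OF \<Omega> f] s' by (auto simp: antimono_def)
    with s s' show False by auto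
  qed
  then have "emeasure lborel ?D \<le> emeasure lborel {l<..r}"
    by (rule emeasure_mono) simp
  also have "\<dots> = ennreal (r - l)"
    using l r by (simp add: ennreal_le_iff)
  finally have "ennreal l + emeasure lborel ?D \<le> ennreal l + ennreal (r - l)"
    by (rule add_left_mono)
  also have "\<dots> = ennreal r"
    using l r by (simp add: ennreal_le_iff flip: ennreal_plus)
  finally show ?thesis using r by simp
qed simp

section \<open>Layer-cake formulas and the two halves of the K-functional identity\<close>

lemma sigma_finite_lebesgue: "sigma_finite_measure (lebesgue :: 'a::euclidean_space measure)"
proof -
  obtain A :: "'a set set" where "countable A" "A \<subseteq> sets lborel" "\<Union>A = space lborel"
      "\<forall>a\<in>A. emeasure lborel a \<noteq> \<infinity>"
    using lborel.sigma_finite_countable by auto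
  then have "countable A \<and> A \<subseteq> sets lebesgue \<and> \<Union>A = space lebesgue \<and> (\<forall>a\<in>A. emeasure lebesgue a \<noteq> \<infinity>)"
    by (auto simp: subset_eq)
  then show ?thesis
    unfolding sigma_finite_measure_def by blast
qed

text \<open>Layer-cake formula: Tonelli on the region between the level \<open>l\<close> and the
  graph of \<open>\<bar>f\<bar>\<close>. As \<open>ennreal\<close> sends negative numbers to 0,
  \<open>ennreal (\<bar>f x\<bar> - l)\<close> is the positive part, here and below.\<close>

lemma nn_integral_excess:
  fixes f :: "'a::euclidean_space \<Rightarrow> real"
  assumes \<Omega>: "\<Omega> \<in> sets lebesgue" and f: "f \<in> borel_measurable (lebesgue_on \<Omega>)" and l: "0 \<le> l"
  shows "(\<integral>\<^sup>+x\<in>\<Omega>. ennreal (\<bar>f x\<bar> - l) \<partial>lebesgue) =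
    (\<integral>\<^sup>+s\<in>{l<..}. emeasure lebesgue {x \<in> \<Omega>. \<bar>f x\<bar> > s} \<partial>lborel)"
proof -
  \<comment> \<open>Extension by zero moves everything to the whole space; since
    \<open>0 \<le> l\<close>, points outside \<open>\<Omega>\<close> contribute nothing to
    \<open>P\<close>.\<close>
  define g where "g x = (if x \<in> \<Omega> then \<bar>f x\<bar> else 0)" for x
  have g[measurable]: "g \<in> borel_measurable lebesgue"
    unfolding g_def using f \<Omega>
    by (subst borel_measurable_if) (auto intro!: borel_measurable_abs)
  interpret L: sigma_finite_measure "lebesgue :: 'a measure"
    by (rule sigma_finite_lebesgue)
  interpret pair_sigma_finite "lebesgue :: 'a measure" "lborel :: real measure" ..
  define P where "P = {z :: 'a \<times> real. l < snd z \<and> snd z < g (fst z)}"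
  have [measurable]: "P \<in> sets (lebesgue \<Otimes>\<^sub>M lborel)"
  proof -
    have "{z \<in> space (lebesgue \<Otimes>\<^sub>M lborel). l < snd z \<and> snd z < g (fst z)}
        \<in> sets (lebesgue \<Otimes>\<^sub>M lborel :: ('a \<times> real) measure)"
      by measurable
    then show ?thesis by (simp add: P_def space_pair_measure)
  qed
  have "(\<integral>\<^sup>+x\<in>\<Omega>. ennreal (\<bar>f x\<bar> - l) \<partial>lebesgue) = (\<integral>\<^sup>+x. \<integral>\<^sup>+s. indicator P (x, s) \<partial>lborel \<partial>lebesgue)"
  proof (intro nn_integral_cong)
    fix x
    have "(\<integral>\<^sup>+s. indicator P (x, s) \<partial>lborel) = (\<integral>\<^sup>+s. indicator {l<..<g x} s \<partial>lborel)"
      by (intro nn_integral_cong) (auto simp: P_def split: split_indicator)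
    also have "\<dots> = ennreal (g x - l)"
      by (cases "l \<le> g x") (auto simp: ennreal_neg)
    finally show "ennreal (\<bar>f x\<bar> - l) * indicator \<Omega> x = (\<integral>\<^sup>+s. indicator P (x, s) \<partial>lborel)"
      using l by (auto simp: g_def ennreal_neg)
  qed
  also have "\<dots> = (\<integral>\<^sup>+s. \<integral>\<^sup>+x. indicator P (x, s) \<partial>lebesgue \<partial>lborel)"
    by (rule Fubini'[symmetric]) measurable
  also have "\<dots> = (\<integral>\<^sup>+s\<in>{l<..}. emeasure lebesgue {x \<in> \<Omega>. \<bar>f x\<bar> > s} \<partial>lborel)"
  proof (intro nn_integral_cong)
    fix s
    have "(\<integral>\<^sup>+x. indicator P (x, s) \<partial>lebesgue) =
        (\<integral>\<^sup>+x. indicator {x \<in> \<Omega>. \<bar>f x\<bar> > s} x * indicator {l<..} s \<partial>lebesgue)"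
      using l by (intro nn_integral_cong) (auto simp: P_def g_def split: split_indicator if_splits)
    then show "(\<integral>\<^sup>+x. indicator P (x, s) \<partial>lebesgue) =
        emeasure lebesgue {x \<in> \<Omega>. \<bar>f x\<bar> > s} * indicator {l<..} s"
      using sets_superlevel[OF \<Omega> f] by (simp add: nn_integral_multc)
  qed
  finally show ?thesis .
qed

text \<open>Tonelli on the region under \<open>m\<close>, cut at \<open>t\<close> and above the
  level \<open>l\<close>. When \<open>m\<close> is the distribution function of \<open>f\<close>,
  the left side measures the excess of the rearrangement over \<open>l\<close> on (0,t); for
  positive \<open>t\<close> the slices on the right have length min(t, m s).\<close>

lemma nn_integral_slices:
  fixes m :: "real \<Rightarrow> ennreal"
  assumes m: "antimono m"
  shows "(\<integral>\<^sup>+u\<in>{0<..<t}. emeasure lborel {s. l < s \<and> ennreal u < m s} \<partial>lborel) =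
    (\<integral>\<^sup>+s\<in>{l<..}. emeasure lborel {u. 0 < u \<and> u < t \<and> ennreal u < m s} \<partial>lborel)"
proof -
  have [measurable]: "m \<in> borel_measurable borel"
    using m by (rule borel_measurable_antimono_ennreal)
  define P where "P = {z :: real \<times> real. 0 < fst z \<and> fst z < t \<and> l < snd z \<and> ennreal (fst z) < m (snd z)}"
  have [measurable]: "P \<in> sets (lborel \<Otimes>\<^sub>M lborel)"
  proof -
    have "{z \<in> space (lborel \<Otimes>\<^sub>M lborel). 0 < fst z \<and> fst z < t \<and> l < snd z \<and> ennreal (fst z) < m (snd z)}
        \<in> sets (lborel \<Otimes>\<^sub>M lborel :: (real \<times> real) measure)"
      by measurable
    then show ?thesis by (simp add: P_def space_pair_measure)
  qed
  have "(\<integral>\<^sup>+u\<in>{0<..<t}. emeasure lborel {s. l < s \<and> ennreal u < m s} \<partial>lborel) =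
      (\<integral>\<^sup>+u. \<integral>\<^sup>+s. indicator P (u, s) \<partial>lborel \<partial>lborel)"
    by (intro nn_integral_cong)
       (auto simp: P_def simp flip: nn_integral_indicator nn_integral_multc intro!: nn_integral_cong split: split_indicator)
  also have "\<dots> = (\<integral>\<^sup>+s. \<integral>\<^sup>+u. indicator P (u, s) \<partial>lborel \<partial>lborel)"
    by (rule lborel_pair.Fubini'[symmetric]) measurable
  also have "\<dots> = (\<integral>\<^sup>+s\<in>{l<..}. emeasure lborel {u. 0 < u \<and> u < t \<and> ennreal u < m s} \<partial>lborel)"
    by (intro nn_integral_cong)
       (auto simp: P_def simp flip: nn_integral_indicator nn_integral_multc intro!: nn_integral_cong split: split_indicator)
  finally show ?thesis .
qed

text \<open>Upper half of the K-functional identity, for every level: \<open>rearr_le\<close> bounds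
  the rearrangement by \<open>l\<close> plus a length, \<open>nn_integral_slices\<close> exchanges
  the integrals, and dropping the cap \<open>t\<close> on the slices leaves the integral of
  \<open>nn_integral_excess\<close>.\<close>

lemma nn_integral_rearr_le:
  fixes f :: "'a::euclidean_space \<Rightarrow> real"
  assumes \<Omega>: "\<Omega> \<in> sets lebesgue" and f: "f \<in> borel_measurable (lebesgue_on \<Omega>)"
    and l: "0 \<le> l" and t: "0 < t"
  shows "(\<integral>\<^sup>+u\<in>{0<..<t}. rearr \<Omega> f u \<partial>lborel) \<le>
    (\<integral>\<^sup>+x\<in>\<Omega>. ennreal (\<bar>f x\<bar> - l) \<partial>lebesgue) + ennreal (l * t)"
proof -
  define m where "m s = emeasure lebesgue {x \<in> \<Omega>. \<bar>f x\<bar> > s}" for s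
  have m: "antimono m"
    unfolding m_def using \<Omega> f by (rule antimono_distribution)
  have [measurable]: "m \<in> borel_measurable borel"
    using m by (rule borel_measurable_antimono_ennreal)
  have [measurable]: "(\<lambda>u. emeasure lborel {s. l < s \<and> ennreal u < m s}) \<in> borel_measurable borel"
    by measurable
  have "(\<integral>\<^sup>+u\<in>{0<..<t}. rearr \<Omega> f u \<partial>lborel) \<le>
     (\<integral>\<^sup>+u. ennreal l * indicator {0<..<t} u + emeasure lborel {s. l < s \<and> ennreal u < m s} * indicator {0<..<t} u \<partial>lborel)"
    using rearr_le[OF \<Omega> f l]
    by (intro nn_integral_mono) (auto simp: m_def split: split_indicator)
  also have "\<dots> = ennreal (l * t) + (\<integral>\<^sup>+u\<in>{0<..<t}. emeasure lborel {s. l < s \<and> ennreal u < m s} \<partial>lborel)"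
    using l t by (subst nn_integral_add) (auto simp: nn_integral_cmult ennreal_mult)
  also have "(\<integral>\<^sup>+u\<in>{0<..<t}. emeasure lborel {s. l < s \<and> ennreal u < m s} \<partial>lborel) =
      (\<integral>\<^sup>+s\<in>{l<..}. emeasure lborel {u. 0 < u \<and> u < t \<and> ennreal u < m s} \<partial>lborel)"
    by (rule nn_integral_slices[OF m])
  also have "\<dots> \<le> (\<integral>\<^sup>+s\<in>{l<..}. m s \<partial>lborel)"
  proof (intro nn_integral_mono mult_right_mono)
    fix s
    show "emeasure lborel {u. 0 < u \<and> u < t \<and> ennreal u < m s} \<le> m s"
    proof (cases "m s = top")
      case False
      then obtain r where r: "0 \<le> r" "m s = ennreal r" by (metis ennreal_cases)
      then have "emeasure lborel {u. 0 < u \<and> u < t \<and> ennreal u < m s} \<le> emeasure lborel {0<..<r}"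
        by (intro emeasure_mono) (auto simp: ennreal_less_iff)
      then show ?thesis using r by simp
    qed simp
  qed simp
  finally show ?thesis
    unfolding nn_integral_excess[OF \<Omega> f l] m_def by (simp add: add.commute)
qed

text \<open>The optimal level is \<open>rearr \<Omega> f t\<close>. Above it the distribution
  function is at most \<open>t\<close>, so the cap in \<open>nn_integral_slices\<close> is inactive;
  on (0,t) the rearrangement is at least this level, so \<open>le_rearr\<close> applies.\<close>

lemma nn_integral_rearr_ge:
  fixes f :: "'a::euclidean_space \<Rightarrow> real"
  assumes \<Omega>: "\<Omega> \<in> sets lebesgue" and f: "f \<in> borel_measurable (lebesgue_on \<Omega>)" and t: "0 < t"
    and fin: "(\<integral>\<^sup>+u\<in>{0<..<t}. rearr \<Omega> f u \<partial>lborel) < top"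
  obtains l where "0 \<le> l"
    "(\<integral>\<^sup>+x\<in>\<Omega>. ennreal (\<bar>f x\<bar> - l) \<partial>lebesgue) + ennreal (l * t) \<le> (\<integral>\<^sup>+u\<in>{0<..<t}. rearr \<Omega> f u \<partial>lborel)"
proof -
  have anti: "rearr \<Omega> f t \<le> rearr \<Omega> f u" if "u \<le> t" for u
    using antimono_rearr that by (auto simp: antimono_def)
  \<comment> \<open>By monotonicity an infinite value at \<open>t\<close> would persist on all of
    (0,t), against \<open>fin\<close>; so the optimal level is a real number.\<close>
  have "rearr \<Omega> f t \<noteq> top"
  proof
    assume "rearr \<Omega> f t = top"
    then have "top * ennreal t \<le> (\<integral>\<^sup>+u\<in>{0<..<t}. rearr \<Omega> f u \<partial>lborel)"
      using t anti nn_integral_mono[of lborel "\<lambda>u. top * indicator {0<..<t} u" "\<lambda>u. rearr \<Omega> f u * indicator {0<..<t} u"]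
      by (auto simp: nn_integral_cmult top_unique split: split_indicator)
    with fin t show False by (simp add: ennreal_top_mult top_unique)
  qed
  then obtain l where l: "0 \<le> l" "rearr \<Omega> f t = ennreal l"
    by (metis ennreal_cases)
  define m where "m s = emeasure lebesgue {x \<in> \<Omega>. \<bar>f x\<bar> > s}" for s
  have m: "antimono m"
    unfolding m_def using \<Omega> f by (rule antimono_distribution)
  have [measurable]: "m \<in> borel_measurable borel"
    using m by (rule borel_measurable_antimono_ennreal)
  have [measurable]: "(\<lambda>u. emeasure lborel {s. l < s \<and> ennreal u < m s}) \<in> borel_measurable borel"
    by measurable
  have "(\<integral>\<^sup>+s\<in>{l<..}. m s \<partial>lborel) \<le> (\<integral>\<^sup>+s\<in>{l<..}. emeasure lborel {u. 0 < u \<and> u < t \<and> ennreal u < m s} \<partial>lborel)"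
  proof (intro nn_integral_mono)
    fix s
    have "m s \<le> emeasure lborel {u. 0 < u \<and> u < t \<and> ennreal u < m s}" if s: "l < s"
    proof -
      from s l have "rearr \<Omega> f t < ennreal s" by (simp add: ennreal_less_iff)
      then obtain s' where s': "s' < s" "m s' \<le> ennreal t"
        unfolding rearr_def Inf_less_iff by (auto simp: ennreal_less_iff m_def)
      then have "m s \<le> ennreal t"
        using antimonoD[OF m, of s' s] by simp
      then obtain r where r: "0 \<le> r" "m s = ennreal r" "r \<le> t"
        using t by (metis ennreal_cases ennreal_le_iff ennreal_neq_top less_imp_le top_unique)
      then have "emeasure lborel {0<..<r} \<le> emeasure lborel {u. 0 < u \<and> u < t \<and> ennreal u < m s}"
        by (intro emeasure_mono) (auto simp: ennreal_less_iff)
      then show ?thesis using r by simp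
    qed
    then show "m s * indicator {l<..} s \<le>
        emeasure lborel {u. 0 < u \<and> u < t \<and> ennreal u < m s} * indicator {l<..} s"
      by (auto split: split_indicator)
  qed
  also have "\<dots> = (\<integral>\<^sup>+u\<in>{0<..<t}. emeasure lborel {s. l < s \<and> ennreal u < m s} \<partial>lborel)"
    by (rule nn_integral_slices[OF m, symmetric])
  finally have "(\<integral>\<^sup>+s\<in>{l<..}. m s \<partial>lborel) + ennreal (l * t) \<le>
      (\<integral>\<^sup>+u\<in>{0<..<t}. emeasure lborel {s. l < s \<and> ennreal u < m s} \<partial>lborel) + ennreal (l * t)"
    by (rule add_right_mono)
  also have "\<dots> = (\<integral>\<^sup>+u. ennreal l * indicator {0<..<t} u + emeasure lborel {s. l < s \<and> ennreal u < m s} * indicator {0<..<t} u \<partial>lborel)"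
    using l t by (subst nn_integral_add) (auto simp: nn_integral_cmult ennreal_mult add.commute)
  also have "\<dots> \<le> (\<integral>\<^sup>+u\<in>{0<..<t}. rearr \<Omega> f u \<partial>lborel)"
    using le_rearr[OF \<Omega> f l(1)] anti l
    by (intro nn_integral_mono) (auto simp: m_def split: split_indicator)
  finally show ?thesis
    using that[OF l(1)] unfolding nn_integral_excess[OF \<Omega> f l(1)] m_def by simp
qed

section \<open>Comparison of Lorentz norms\<close>

lemma mult_avg_rearr:
  assumes "0 < t"
  shows "ennreal t * avg_rearr \<Omega> f t = (\<integral>\<^sup>+u\<in>{0<..<t}. rearr \<Omega> f u \<partial>lborel)"
  using assms
  by (simp add: avg_rearr_def mult.assoc[symmetric] ennreal_mult[symmetric])

text \<open>The substitution u = t v fixes the interval of integration, so that monotonicity in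
  \<open>t\<close> is inherited pointwise from \<open>rearr\<close>.\<close>

lemma avg_rearr_rescale:
  assumes "0 < t"
  shows "avg_rearr \<Omega> f t = (\<integral>\<^sup>+v\<in>{0<..<1}. rearr \<Omega> f (t * v) \<partial>lborel)"
proof -
  have "(\<integral>\<^sup>+u\<in>{0<..<t}. rearr \<Omega> f u \<partial>lborel) =
      ennreal t * (\<integral>\<^sup>+v. rearr \<Omega> f (t * v) * indicator {0<..<t} (t * v) \<partial>lborel)"
    using assms by (subst nn_integral_real_affine[where c=t and t=0]) auto
  also have "(\<integral>\<^sup>+v. rearr \<Omega> f (t * v) * indicator {0<..<t} (t * v) \<partial>lborel) =
      (\<integral>\<^sup>+v\<in>{0<..<1}. rearr \<Omega> f (t * v) \<partial>lborel)"
    using assms by (intro nn_integral_cong) (auto simp: zero_less_mult_iff split: split_indicator)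
  finally show ?thesis
    using assms by (simp add: avg_rearr_def mult.assoc[symmetric] ennreal_mult[symmetric])
qed

lemma avg_rearr_antimono:
  assumes "0 < t" "t \<le> u"
  shows "avg_rearr \<Omega> f u \<le> avg_rearr \<Omega> f t"
proof -
  have "rearr \<Omega> f (u * v) \<le> rearr \<Omega> f (t * v)" if "0 < v" for v
    using assms that by (intro antimonoD[OF antimono_rearr]) auto
  then show ?thesis
    using assms unfolding avg_rearr_rescale[OF assms(1)] avg_rearr_rescale[OF less_le_trans[OF assms]]
    by (intro nn_integral_mono) (auto split: split_indicator)
qed

lemma borel_measurable_avg_rearr [measurable]: "avg_rearr \<Omega> f \<in> borel_measurable borel"
proof -
  \<comment> \<open>The moving endpoint becomes a jointly measurable indicator, which makes this a
    parametric integral of a measurable function.\<close>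
  have "(\<lambda>t. \<integral>\<^sup>+s. rearr \<Omega> f s * indicator {z. 0 < snd z \<and> snd z < fst z} (t, s) \<partial>lborel)
      \<in> borel_measurable borel"
    by measurable
  also have "(\<lambda>t. \<integral>\<^sup>+s. rearr \<Omega> f s * indicator {z. 0 < snd z \<and> snd z < fst z} (t, s) \<partial>lborel) =
     (\<lambda>t. \<integral>\<^sup>+s\<in>{0<..<t}. rearr \<Omega> f s \<partial>lborel)"
    by (intro ext nn_integral_cong) (auto split: split_indicator)
  finally have [measurable]: "(\<lambda>t. \<integral>\<^sup>+s\<in>{0<..<t}. rearr \<Omega> f s \<partial>lborel) \<in> borel_measurable borel" .
  show ?thesis
    unfolding avg_rearr_def[abs_def] by measurable
qed

lemma ennpow_mono:
  assumes "a \<le> b" "0 \<le> p"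
  shows "ennpow a p \<le> ennpow b p"
  using assms by (cases a; cases b) (auto simp: ennpow_def top_unique intro!: ennreal_leI powr_mono2)

lemma ennpow_cmult:
  assumes "0 < k"
  shows "ennpow (ennreal k * a) p = ennreal (k powr p) * ennpow a p"
  using assms
  by (cases a) (auto simp: ennpow_def ennreal_mult_top ennreal_mult[symmetric] powr_mult)

lemma borel_measurable_ennpow [measurable]:
  assumes [measurable]: "f \<in> borel_measurable M"
  shows "(\<lambda>x. ennpow (f x) p) \<in> borel_measurable M"
  unfolding ennpow_def by measurable

lemma nn_integral_powr_from_0:
  assumes "0 < a" "0 < (A::real)"
  shows "(\<integral>\<^sup>+u\<in>{0<..<A}. ennreal (u powr (a - 1)) \<partial>lborel) = ennreal (A powr a / a)"
proof -
  have "((\<lambda>u. u powr (a - 1)) has_integral (A powr a / a)) {0..A}"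
    using has_integral_powr_from_0[of "a - 1" A] assms by simp
  then have "((\<lambda>u. u powr (a - 1)) has_integral (A powr a / a)) {0<..<A}"
    by (simp add: has_integral_Icc_iff_Ioo)
  moreover have eq: "(\<lambda>u. indicator {0<..<A} u * u powr (a - 1)) = (\<lambda>u. if u \<in> {0<..<A} then u powr (a - 1) else 0)"
    by (auto split: split_indicator)
  ultimately have "((\<lambda>u. indicator {0<..<A} u * u powr (a - 1)) has_integral (A powr a / a)) UNIV"
    by (simp only: eq has_integral_restrict_UNIV)
  then have "(\<integral>\<^sup>+u. ennreal (indicator {0<..<A} u * u powr (a - 1)) \<partial>lborel) = ennreal (A powr a / a)"
    by (rule nn_integral_has_integral_lborel[rotated 2]) auto
  then show ?thesis
    by (simp add: ennreal_mult mult.commute ennreal_indicator)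
qed

text \<open>Rescale the norm of \<open>g\<close> by t = k u. For u at least \<open>A\<close> use
  \<open>dil\<close>: the surplus power of u is largest at \<open>A\<close> because
  \<open>d1 < d2\<close>. For u below \<open>A\<close> use \<open>bdd\<close>: the resulting
  constant is integrable against the power at 0 and is absorbed by the norm of \<open>f\<close> over
  (0,A). The factor \<open>d2 / d1\<close> compares the integrals of u powr (p/d2 - 1) and u powr
  (p/d1 - 1) over (0,A).\<close>

lemma lorentz_norm_le:
  fixes f :: "'a::euclidean_space \<Rightarrow> real" and g :: "'b::euclidean_space \<Rightarrow> real"
  assumes d: "0 < d1" "d1 < d2" and r: "1 \<le> r"
    and pos: "0 < c" "0 < k" "0 < A"
    and dil: "\<And>s. 0 < s \<Longrightarrow> avg_rearr \<Omega>' g (k * s) \<le> ennreal c * avg_rearr \<Omega> f s"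
    and bdd: "\<And>s. 0 < s \<Longrightarrow> avg_rearr \<Omega>' g s \<le> ennreal c * avg_rearr \<Omega> f A"
  shows "lorentz_norm \<Omega>' d2 r g \<le>
    ennreal (d2 / d1 * (c * k powr (1 / d2) * A powr (1 / d2 - 1 / d1))) * lorentz_norm \<Omega> d1 r f"
proof -
  define P where "P = avg_rearr \<Omega> f"
  define Q where "Q = avg_rearr \<Omega>' g"
  define b where "b = c * k powr (1 / d2) * A powr (1 / d2 - 1 / d1)"
  have b: "0 < b" using pos by (simp add: b_def)
  have [measurable]: "P \<in> borel_measurable borel" "Q \<in> borel_measurable borel"
    by (simp_all add: P_def Q_def)
  have neg: "1 / d2 - 1 / d1 \<le> 0" using d by (simp add: field_simps)
  have 1: "1 \<le> d2 / d1" using d by simp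
  have large: "ennreal ((k * u) powr (1 / d2)) * Q (k * u) \<le> ennreal b * (ennreal (u powr (1 / d1)) * P u)"
    if u: "A \<le> u" for u
  proof -
    have u0: "0 < u" using u pos by simp
    have "u powr (1 / d2 - 1 / d1) \<le> A powr (1 / d2 - 1 / d1)"
      using neg u pos by (intro powr_mono2') auto
    then have "c * k powr (1 / d2) * (u powr (1 / d2 - 1 / d1) * u powr (1 / d1)) \<le> b * u powr (1 / d1)"
      unfolding b_def mult.assoc using pos by (intro mult_left_mono mult_right_mono) auto
    then have le: "c * (k * u) powr (1 / d2) \<le> b * u powr (1 / d1)"
      using pos u0 by (simp add: powr_mult mult.assoc flip: powr_add)
    have "ennreal ((k * u) powr (1 / d2)) * Q (k * u) \<le> ennreal ((k * u) powr (1 / d2)) * (ennreal c * P u)"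
      unfolding P_def Q_def using u0 by (intro mult_left_mono dil) auto
    also have "\<dots> = ennreal (c * (k * u) powr (1 / d2)) * P u"
      using pos by (simp add: ennreal_mult mult_ac)
    also have "\<dots> \<le> ennreal (b * u powr (1 / d1)) * P u"
      using le by (intro mult_right_mono ennreal_leI) auto
    finally show ?thesis
      using b by (simp add: ennreal_mult mult_ac)
  qed
  \<comment> \<open>Here \<open>P\<close> is frozen at \<open>A\<close>. The constant
    \<open>b\<close> is factored out as in \<open>large\<close>, and the extra power of
    \<open>A\<close> undoes the one inside \<open>b\<close>.\<close>
  have small: "ennreal ((k * u) powr (1 / d2)) * Q (k * u) \<le>
      ennreal b * (ennreal (A powr (1 / d1 - 1 / d2)) * (ennreal (u powr (1 / d2)) * P A))"
    if u: "0 < u" for u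
  proof -
    have "ennreal ((k * u) powr (1 / d2)) * Q (k * u) \<le> ennreal ((k * u) powr (1 / d2)) * (ennreal c * P A)"
      unfolding P_def Q_def using u pos by (intro mult_left_mono bdd) auto
    also have "\<dots> = ennreal (c * (k * u) powr (1 / d2)) * P A"
      using pos by (simp add: ennreal_mult mult_ac)
    also have "c * (k * u) powr (1 / d2) = b * (A powr (1 / d1 - 1 / d2) * u powr (1 / d2))"
      using pos u by (simp add: b_def powr_mult mult_ac) (simp add: powr_diff)
    finally show ?thesis
      using b by (simp add: ennreal_mult mult_ac)
  qed
  show ?thesis
  proof (cases "r = \<infinity>")
    case True
    have "ennreal (t powr (1 / d2)) * Q t \<le> ennreal b * (SUP t\<in>{0<..}. ennreal (t powr (1 / d1)) * P t)"
      if t: "0 < t" for t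
    proof -
      define u where "u = t / k"
      have u: "0 < u" "t = k * u" using t pos by (auto simp: u_def)
      \<comment> \<open>The witness is \<open>u\<close> itself when \<open>A \<le> u\<close>, and
        \<open>A\<close> otherwise.\<close>
      have "\<exists>v>0. ennreal (t powr (1 / d2)) * Q t \<le> ennreal b * (ennreal (v powr (1 / d1)) * P v)"
      proof (cases "A \<le> u")
        case True
        then show ?thesis using large u by blast
      next
        case False
        have "A powr (1 / d1 - 1 / d2) * u powr (1 / d2) \<le> A powr (1 / d1 - 1 / d2) * A powr (1 / d2)"
          using False u d by (intro mult_left_mono powr_mono2) auto
        also have "\<dots> = A powr (1 / d1)"
          by (simp flip: powr_add)
        finally have "ennreal (A powr (1 / d1 - 1 / d2) * u powr (1 / d2)) * P A \<le> ennreal (A powr (1 / d1)) * P A"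
          by (intro mult_right_mono ennreal_leI) auto
        then have "ennreal (t powr (1 / d2)) * Q t \<le> ennreal b * (ennreal (A powr (1 / d1)) * P A)"
          using order_trans[OF small[OF u(1)] mult_left_mono] u(2)
          by (simp add: ennreal_mult mult.assoc)
        then show ?thesis using pos by blast
      qed
      then obtain v where v: "0 < v" "ennreal (t powr (1 / d2)) * Q t \<le> ennreal b * (ennreal (v powr (1 / d1)) * P v)"
        by blast
      note v(2)
      also have "ennreal b * (ennreal (v powr (1 / d1)) * P v) \<le> ennreal b * (SUP t\<in>{0<..}. ennreal (t powr (1 / d1)) * P t)"
        using v(1) by (intro mult_left_mono SUP_upper) auto
      finally show ?thesis .
    qed
    then have "lorentz_norm \<Omega>' d2 r g \<le> ennreal b * lorentz_norm \<Omega> d1 r f"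
      using True by (auto simp: lorentz_norm_def P_def Q_def intro!: SUP_least)
    \<comment> \<open>The supremum case holds with \<open>b\<close> alone; the factor
      \<open>d2 / d1\<close>, at least 1, gives one constant for all \<open>r\<close>.\<close>
    also have "\<dots> \<le> ennreal (d2 / d1 * b) * lorentz_norm \<Omega> d1 r f"
      using mult_right_mono[OF 1, of b] b by (intro mult_right_mono ennreal_leI) auto
    finally show ?thesis by (simp add: b_def)
  next
    case False
    define p where "p = enn2real r"
    have p: "1 \<le> p"
      using r False by (cases r) (auto simp: p_def)
    define F where "F u = ennpow (ennreal (u powr (1 / d1)) * P u) p * ennreal (1 / u)" for u
    define G where "G u = ennpow (ennreal (u powr (1 / d2)) * Q u) p * ennreal (1 / u)" for u
    have [measurable]: "F \<in> borel_measurable borel" "G \<in> borel_measurable borel"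
      by (simp_all add: F_def[abs_def] G_def[abs_def])
    define w where "w = ennpow (P A) p"
    \<comment> \<open>The measure dt/t is dilation invariant: the Jacobian \<open>k\<close> cancels
      against the \<open>k\<close> in \<open>1 / (k * u)\<close>.\<close>
    have scale: "ennreal k * G (k * u) = ennpow (ennreal ((k * u) powr (1 / d2)) * Q (k * u)) p * ennreal (1 / u)"
      if "0 < u" for u
      using that pos unfolding G_def
      by (subst mult.left_commute) (simp flip: ennreal_mult)
    have Glarge: "ennreal k * G (k * u) \<le> ennreal (b powr p) * F u" if u: "A \<le> u" for u
    proof -
      have "ennpow (ennreal ((k * u) powr (1 / d2)) * Q (k * u)) p \<le> ennpow (ennreal b * (ennreal (u powr (1 / d1)) * P u)) p"
        using p by (intro ennpow_mono large[OF u]) auto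
      then show ?thesis
        using u pos b unfolding scale[OF less_le_trans[OF pos(3) u]] F_def mult.assoc[symmetric]
        by (intro mult_right_mono) (auto simp: ennpow_cmult mult.assoc)
    qed
    have Gsmall: "ennreal k * G (k * u) \<le>
        ennreal (b powr p * A powr (p / d1 - p / d2)) * w * ennreal (u powr (p / d2 - 1))" if u: "0 < u" for u
    proof -
      have "ennreal k * G (k * u) \<le> ennpow (ennreal b * (ennreal (A powr (1 / d1 - 1 / d2)) * (ennreal (u powr (1 / d2)) * P A))) p * ennreal (1 / u)"
        unfolding scale[OF u] using p by (intro mult_right_mono ennpow_mono small[OF u]) auto
      also have "\<dots> = ennreal (b powr p) * (ennreal (A powr (p / d1 - p / d2)) * (ennreal (u powr (p / d2)) * w)) * ennreal (1 / u)"
        using b pos u by (simp add: ennpow_cmult w_def powr_powr left_diff_distrib)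
      also have "\<dots> = ennreal (b powr p * A powr (p / d1 - p / d2)) * w * (ennreal (u powr (p / d2)) * ennreal (1 / u))"
        by (simp add: ennreal_mult mult_ac)
      also have "ennreal (u powr (p / d2)) * ennreal (1 / u) = ennreal (u powr (p / d2 - 1))"
        using u by (simp add: powr_diff flip: ennreal_mult)
      finally show ?thesis .
    qed
    \<comment> \<open>As \<open>P\<close> is antitone, its value at \<open>A\<close> bounds it from
      below on (0,A). This turns the constant \<open>w\<close> of \<open>Gsmall\<close> back into a
      part of the norm of \<open>f\<close>.\<close>
    have low: "w * ennreal (A powr (p / d1) / (p / d1)) \<le> (\<integral>\<^sup>+u\<in>{0<..<A}. F u \<partial>lborel)"
    proof -
      have "w * ennreal (A powr (p / d1) / (p / d1)) = (\<integral>\<^sup>+u. w * (ennreal (u powr (p / d1 - 1)) * indicator {0<..<A} u) \<partial>lborel)"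
        using p d pos by (subst nn_integral_cmult) (auto simp: nn_integral_powr_from_0)
      also have "\<dots> \<le> (\<integral>\<^sup>+u\<in>{0<..<A}. F u \<partial>lborel)"
      proof (intro nn_integral_mono)
        fix u
        have "w * ennreal (u powr (p / d1 - 1)) \<le> F u" if u: "0 < u" "u < A"
        proof -
          have pw: "ennreal (u powr (p / d1 - 1)) = ennreal ((u powr (1 / d1)) powr p) * ennreal (1 / u)"
            using u by (simp add: powr_powr powr_diff flip: ennreal_mult)
          have "w * ennreal (u powr (p / d1 - 1)) = ennpow (ennreal (u powr (1 / d1)) * P A) p * ennreal (1 / u)"
            using u by (subst pw, subst ennpow_cmult) (auto simp: w_def mult_ac)
          also have "\<dots> \<le> F u"
            unfolding F_def P_def using u p by (intro mult_right_mono ennpow_mono mult_left_mono avg_rearr_antimono) auto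
          finally show ?thesis .
        qed
        then show "w * (ennreal (u powr (p / d1 - 1)) * indicator {0<..<A} u) \<le> F u * indicator {0<..<A} u"
          by (auto split: split_indicator)
      qed
      finally show ?thesis .
    qed
    have "(\<integral>\<^sup>+u\<in>{0<..}. G u \<partial>lborel) = (\<integral>\<^sup>+u. ennreal k * (G (k * u) * indicator {0<..} (k * u)) \<partial>lborel)"
      using pos by (subst nn_integral_real_affine[where c=k and t=0]) (auto simp: nn_integral_cmult)
    also have "\<dots> \<le> (\<integral>\<^sup>+u. ennreal (b powr p * A powr (p / d1 - p / d2)) * w * (ennreal (u powr (p / d2 - 1)) * indicator {0<..<A} u)
        + ennreal (b powr p) * (F u * indicator {A..} u) \<partial>lborel)"
      using Gsmall Glarge pos
      by (intro nn_integral_mono) (auto simp: zero_less_mult_iff not_less mult.assoc split: split_indicator)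
    also have "\<dots> = ennreal (b powr p * A powr (p / d1 - p / d2)) * w * ennreal (A powr (p / d2) / (p / d2))
        + ennreal (b powr p) * (\<integral>\<^sup>+u\<in>{A..}. F u \<partial>lborel)"
      using p d pos by (subst nn_integral_add) (auto simp: nn_integral_cmult nn_integral_powr_from_0)
    \<comment> \<open>The powers of \<open>A\<close> combine to the one in \<open>low\<close>;
      replacing the denominator \<open>p / d2\<close> by \<open>p / d1\<close> costs the factor
      \<open>d2 / d1\<close>.\<close>
    also have "ennreal (b powr p * A powr (p / d1 - p / d2)) * w * ennreal (A powr (p / d2) / (p / d2)) =
        ennreal (b powr p * (d2 / d1)) * (w * ennreal (A powr (p / d1) / (p / d1)))"
    proof -
      have "A powr (p / d1 - p / d2) * A powr (p / d2) = A powr (p / d1)"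
        by (simp flip: powr_add)
      moreover have "y * x1 * (x2 / (p / d2)) = y * (d2 / d1) * (x3 / (p / d1))" if "x1 * x2 = x3" for x1 x2 x3 y :: real
        using that p d by (auto simp: field_simps)
      ultimately have eq: "b powr p * A powr (p / d1 - p / d2) * (A powr (p / d2) / (p / d2)) =
          b powr p * (d2 / d1) * (A powr (p / d1) / (p / d1))"
        by blast
      have pull: "ennreal x * w * ennreal y = ennreal (x * y) * w" "ennreal x * (w * ennreal y) = ennreal (x * y) * w"
        if "0 \<le> x" "0 \<le> y" for x y
        using that by (auto simp: ennreal_mult mult_ac)
      show ?thesis
        using p d by (subst pull(1), simp, simp, subst pull(2), simp, simp, simp only: eq)
    qed
    also have "\<dots> + ennreal (b powr p) * (\<integral>\<^sup>+u\<in>{A..}. F u \<partial>lborel) \<le>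
        ennreal (b powr p * (d2 / d1)) * (\<integral>\<^sup>+u\<in>{0<..<A}. F u \<partial>lborel) + ennreal (b powr p * (d2 / d1)) * (\<integral>\<^sup>+u\<in>{A..}. F u \<partial>lborel)"
      using 1 mult_left_mono[OF 1, of "b powr p"] by (intro add_mono mult_mono low ennreal_leI) auto
    also have "\<dots> = ennreal (b powr p * (d2 / d1)) * (\<integral>\<^sup>+u. F u * indicator {0<..<A} u + F u * indicator {A..} u \<partial>lborel)"
      by (subst nn_integral_add) (auto simp: distrib_left)
    also have "(\<integral>\<^sup>+u. F u * indicator {0<..<A} u + F u * indicator {A..} u \<partial>lborel) = (\<integral>\<^sup>+u\<in>{0<..}. F u \<partial>lborel)"
      using pos by (intro nn_integral_cong) (auto split: split_indicator)
    finally have main: "(\<integral>\<^sup>+u\<in>{0<..}. G u \<partial>lborel) \<le> ennreal (b powr p * (d2 / d1)) * (\<integral>\<^sup>+u\<in>{0<..}. F u \<partial>lborel)" .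
    have norm_eq: "lorentz_norm \<Omega>' d2 r g = ennpow (\<integral>\<^sup>+u\<in>{0<..}. G u \<partial>lborel) (1 / p)"
      "lorentz_norm \<Omega> d1 r f = ennpow (\<integral>\<^sup>+u\<in>{0<..}. F u \<partial>lborel) (1 / p)"
      using False by (simp_all add: lorentz_norm_def F_def G_def P_def Q_def p_def)
    have "lorentz_norm \<Omega>' d2 r g \<le> ennreal ((b powr p * (d2 / d1)) powr (1 / p)) * lorentz_norm \<Omega> d1 r f"
      using ennpow_mono[OF main, of "1 / p"] p b d unfolding norm_eq by (simp add: ennpow_cmult)
    also have "(b powr p * (d2 / d1)) powr (1 / p) = b * (d2 / d1) powr (1 / p)"
      using p b d by (subst powr_mult) (auto simp: powr_powr)
    \<comment> \<open>Since \<open>1 \<le> p\<close> and \<open>d2 / d1\<close> is at least 1, the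
      root is bounded by \<open>d2 / d1\<close>, which removes the dependence on
      \<open>r\<close>.\<close>
    also have "(d2 / d1) powr (1 / p) \<le> (d2 / d1) powr 1"
      using 1 p by (intro powr_mono) auto
    then have "ennreal (b * (d2 / d1) powr (1 / p)) * lorentz_norm \<Omega> d1 r f \<le> ennreal (d2 / d1 * b) * lorentz_norm \<Omega> d1 r f"
      using b d mult_left_mono[of "(d2 / d1) powr (1 / p)" "d2 / d1" b]
      by (intro mult_right_mono ennreal_leI) (auto simp: mult.commute)
    finally show ?thesis by (simp add: b_def)
  qed
qed

text \<open>An infinite average at \<open>t\<close> would be infinite on all of (0,t] by
  monotonicity and make the norm infinite. Through \<open>nn_integral_rearr_ge\<close>, finiteness
  splits a Lorentz function into an integrable and a bounded part.\<close>

lemma avg_rearr_finite: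
  assumes d: "0 < d" and r: "1 \<le> r" and fin: "lorentz_norm \<Omega> d r f < top" and t: "0 < t"
  shows "avg_rearr \<Omega> f t < top"
proof (rule ccontr)
  assume "\<not> avg_rearr \<Omega> f t < top"
  then have inf: "avg_rearr \<Omega> f u = top" if "0 < u" "u \<le> t" for u
    using avg_rearr_antimono[OF that, of \<Omega> f] by (simp add: top_unique less_top[symmetric])
  show False
  proof (cases "r = \<infinity>")
    case True
    have "ennreal (t powr (1 / d)) * avg_rearr \<Omega> f t \<le> lorentz_norm \<Omega> d r f"
      using True t by (auto simp: lorentz_norm_def intro!: SUP_upper)
    with fin t inf[of t] show False by (simp add: ennreal_mult_top top_unique)
  next
    case False
    have "top * emeasure lborel {0<..<t} \<le>
      (\<integral>\<^sup>+t\<in>{0<..}. ennpow (ennreal (t powr (1 / d)) * avg_rearr \<Omega> f t) (enn2real r) * ennreal (1 / t) \<partial>lborel)"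
      by (subst nn_integral_cmult_indicator[symmetric])
         (auto intro!: nn_integral_mono simp: inf ennreal_mult_top ennpow_def ennreal_top_mult split: split_indicator)
    then have "lorentz_norm \<Omega> d r f = top"
      using t False by (simp add: lorentz_norm_def ennreal_top_mult top_unique ennpow_def)
    with fin show False by simp
  qed
qed

text \<open>Each hypothesis of \<open>lorentz_norm_le\<close> comes from one choice of level: the
  level optimal for \<open>f\<close> at \<open>s\<close> inserted in \<open>L1\<close> gives the
  dilation bound, the one optimal at \<open>A\<close> inserted in \<open>Linf\<close> gives the
  uniform bound. Infinite averages of \<open>f\<close> make either bound trivial.\<close>

lemma lorentz_norm_le_of_excess:
  fixes f :: "'a::euclidean_space \<Rightarrow> real" and g :: "'b::euclidean_space \<Rightarrow> real"
  assumes d: "0 < d1" "d1 < d2" and r: "1 \<le> r" and pos: "0 < c" "0 < k" "0 < A"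
    and \<Omega>: "\<Omega> \<in> sets lebesgue" and f: "f \<in> borel_measurable (lebesgue_on \<Omega>)"
    and \<Omega>': "\<Omega>' \<in> sets lebesgue" and g: "g \<in> borel_measurable (lebesgue_on \<Omega>')"
    and L1: "\<And>l. 0 \<le> l \<Longrightarrow> (\<integral>\<^sup>+x\<in>\<Omega>'. ennreal (\<bar>g x\<bar> - c * l) \<partial>lebesgue) \<le>
      ennreal (c * k) * (\<integral>\<^sup>+x\<in>\<Omega>. ennreal (\<bar>f x\<bar> - l) \<partial>lebesgue)"
    and Linf: "\<And>l x. 0 \<le> l \<Longrightarrow> x \<in> \<Omega>' \<Longrightarrow> ennreal \<bar>g x\<bar> \<le>
      ennreal (c / A) * (\<integral>\<^sup>+x\<in>\<Omega>. ennreal (\<bar>f x\<bar> - l) \<partial>lebesgue) + ennreal (c * l)"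
  shows "lorentz_norm \<Omega>' d2 r g \<le>
    ennreal (d2 / d1 * (c * k powr (1 / d2) * A powr (1 / d2 - 1 / d1))) * lorentz_norm \<Omega> d1 r f"
proof (rule lorentz_norm_le[OF d r pos])
  fix s :: real
  assume s: "0 < s"
  show "avg_rearr \<Omega>' g (k * s) \<le> ennreal c * avg_rearr \<Omega> f s"
  proof (cases "avg_rearr \<Omega> f s = top")
    case True
    then show ?thesis using pos by (simp add: ennreal_mult_top)
  next
    case False
    then have "(\<integral>\<^sup>+u\<in>{0<..<s}. rearr \<Omega> f u \<partial>lborel) < top"
      using s by (simp add: mult_avg_rearr[symmetric] ennreal_mult_less_top less_top)
    \<comment> \<open>This \<open>l\<close> is optimal for \<open>f\<close> at \<open>s\<close>;
      below, \<open>c * l\<close> serves as a competing level for \<open>g\<close> at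
      \<open>k * s\<close>.\<close>
    then obtain l where l: "0 \<le> l"
      "(\<integral>\<^sup>+x\<in>\<Omega>. ennreal (\<bar>f x\<bar> - l) \<partial>lebesgue) + ennreal (l * s) \<le> ennreal s * avg_rearr \<Omega> f s"
      using nn_integral_rearr_ge[OF \<Omega> f s] mult_avg_rearr[OF s] by metis
    have "ennreal (k * s) * avg_rearr \<Omega>' g (k * s) = (\<integral>\<^sup>+u\<in>{0<..<k * s}. rearr \<Omega>' g u \<partial>lborel)"
      using s pos by (simp add: mult_avg_rearr)
    also have "\<dots> \<le> (\<integral>\<^sup>+x\<in>\<Omega>'. ennreal (\<bar>g x\<bar> - c * l) \<partial>lebesgue) + ennreal (c * l * (k * s))"
      using s pos l by (intro nn_integral_rearr_le[OF \<Omega>' g]) auto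
    also have "\<dots> \<le> ennreal (c * k) * (\<integral>\<^sup>+x\<in>\<Omega>. ennreal (\<bar>f x\<bar> - l) \<partial>lebesgue) + ennreal (c * k) * ennreal (l * s)"
      using L1[OF l(1)] l pos s by (intro add_mono) (auto simp: mult_ac simp flip: ennreal_mult)
    also have "\<dots> \<le> ennreal (c * k) * (ennreal s * avg_rearr \<Omega> f s)"
      unfolding distrib_left[symmetric] by (intro mult_left_mono l) simp
    also have "\<dots> = ennreal (k * s) * (ennreal c * avg_rearr \<Omega> f s)"
      using pos s by (simp add: ennreal_mult mult_ac)
    finally show ?thesis
      using pos s by (subst (asm) ennreal_mult_le_mult_iff) auto
  qed
next
  fix s :: real
  assume s: "0 < s"
  show "avg_rearr \<Omega>' g s \<le> ennreal c * avg_rearr \<Omega> f A"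
  proof (cases "avg_rearr \<Omega> f A = top")
    case True
    then show ?thesis using pos by (simp add: ennreal_mult_top)
  next
    case False
    then have "(\<integral>\<^sup>+u\<in>{0<..<A}. rearr \<Omega> f u \<partial>lborel) < top"
      using pos by (simp add: mult_avg_rearr[symmetric] ennreal_mult_less_top less_top)
    then obtain l where l: "0 \<le> l"
      "(\<integral>\<^sup>+x\<in>\<Omega>. ennreal (\<bar>f x\<bar> - l) \<partial>lebesgue) + ennreal (l * A) \<le> ennreal A * avg_rearr \<Omega> f A"
      using nn_integral_rearr_ge[OF \<Omega> f pos(3)] mult_avg_rearr[OF pos(3)] by metis
    \<comment> \<open>With \<open>l\<close> optimal at \<open>A\<close>, the factor 1/A cancels and
      \<open>B\<close> is at most \<open>c\<close> times the average of \<open>f\<close> at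
      \<open>A\<close>. Being finite, \<open>B\<close> can serve as a truncation level for
      \<open>g\<close>, over which there is no excess.\<close>
    define B where "B = ennreal (c / A) * (\<integral>\<^sup>+x\<in>\<Omega>. ennreal (\<bar>f x\<bar> - l) \<partial>lebesgue) + ennreal (c * l)"
    have "B = ennreal (c / A) * ((\<integral>\<^sup>+x\<in>\<Omega>. ennreal (\<bar>f x\<bar> - l) \<partial>lebesgue) + ennreal (l * A))"
      using pos l by (simp add: B_def distrib_left mult_ac flip: ennreal_mult)
    also have "\<dots> \<le> ennreal (c / A) * (ennreal A * avg_rearr \<Omega> f A)"
      by (intro mult_left_mono l) simp
    also have "\<dots> = ennreal c * avg_rearr \<Omega> f A"
      using pos by (simp add: mult.assoc[symmetric] flip: ennreal_mult)
    finally have B: "B \<le> ennreal c * avg_rearr \<Omega> f A" .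
    also have "\<dots> < top" using False by (simp add: ennreal_mult_less_top less_top)
    finally obtain b where b: "0 \<le> b" "B = ennreal b"
      by (cases B rule: ennreal_cases) auto
    have "\<bar>g x\<bar> \<le> b" if "x \<in> \<Omega>'" for x
      using Linf[OF l(1) that] b by (simp add: B_def[symmetric] ennreal_le_iff)
    then have "(\<integral>\<^sup>+x\<in>\<Omega>'. ennreal (\<bar>g x\<bar> - b) \<partial>lebesgue) = (\<integral>\<^sup>+x. 0 \<partial>(lebesgue :: 'b measure))"
      by (intro nn_integral_cong) (auto simp: ennreal_neg split: split_indicator)
    then have "ennreal s * avg_rearr \<Omega>' g s \<le> ennreal s * ennreal b"
      using nn_integral_rearr_le[OF \<Omega>' g b(1) s] b s
      by (simp add: mult_avg_rearr mult.commute flip: ennreal_mult)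
    then have "avg_rearr \<Omega>' g s \<le> ennreal b"
      using s by (subst (asm) ennreal_mult_le_mult_iff) auto
    with B b show ?thesis by simp
  qed
qed

section \<open>The boundary kernel\<close>

text \<open>The Gaussian factors over the coordinates. A general Euclidean space is allowed because
  both the boundary and the one-dimensional normal direction are needed.\<close>

lemma nn_integral_gaussian:
  assumes t: "0 < t"
  shows "(\<integral>\<^sup>+z. ennreal (exp (- (norm (z::'a::euclidean_space))\<^sup>2 / (4 * t))) \<partial>lborel) =
    ennreal ((4 * pi * t) powr (real DIM('a) / 2))"
proof -
  have one: "(\<integral>\<^sup>+x. ennreal (exp (- x\<^sup>2 / (4 * t))) \<partial>lborel) = ennreal (sqrt (4 * pi * t))"
  proof -
    have s: "0 < sqrt (2 * t)" using t by simp
    \<comment> \<open>The standard deviation \<open>sqrt (2 * t)\<close> makes twice the variance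
      equal to \<open>4 * t\<close>.\<close>
    have "(\<integral>\<^sup>+x. ennreal (exp (- x\<^sup>2 / (4 * t))) \<partial>lborel) =
        (\<integral>\<^sup>+x. ennreal (sqrt (4 * pi * t)) * ennreal (normal_density 0 (sqrt (2 * t)) x) \<partial>lborel)"
      using t by (intro nn_integral_cong) (simp add: normal_density_def mult_ac flip: ennreal_mult)
    also have "\<dots> = ennreal (sqrt (4 * pi * t)) * (\<integral>\<^sup>+x. ennreal (normal_density 0 (sqrt (2 * t)) x) \<partial>lborel)"
      by (rule nn_integral_cmult) simp
    also have "(\<integral>\<^sup>+x. ennreal (normal_density 0 (sqrt (2 * t)) x) \<partial>lborel) = 1"
      using s by (simp add: nn_integral_eq_integral integrable_normal_density integral_normal_density)
    finally show ?thesis by simp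
  qed
  have "(\<integral>\<^sup>+z. ennreal (exp (- (norm (z::'a))\<^sup>2 / (4 * t))) \<partial>lborel) =
      (\<integral>\<^sup>+z. (\<Prod>b\<in>(Basis::'a set). ennreal (exp (- (z \<bullet> b)\<^sup>2 / (4 * t)))) \<partial>lborel)"
  proof (intro nn_integral_cong)
    fix z :: 'a
    have "(norm z)\<^sup>2 = (\<Sum>b\<in>Basis. (z \<bullet> b)\<^sup>2)"
      unfolding power2_norm_eq_inner by (subst euclidean_inner) (simp add: power2_eq_square)
    then show "ennreal (exp (- (norm z)\<^sup>2 / (4 * t))) = (\<Prod>b\<in>Basis. ennreal (exp (- (z \<bullet> b)\<^sup>2 / (4 * t))))"
      by (simp add: prod_ennreal exp_sum[symmetric] sum_negf sum_divide_distrib)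
  qed
  also have "\<dots> = (\<Prod>b\<in>(Basis :: 'a set). \<integral>\<^sup>+x. ennreal (exp (- x\<^sup>2 / (4 * t))) \<partial>lborel)"
    using nn_integral_lborel_prod[where f="\<lambda>_ x. exp (- x\<^sup>2 / (4 * t))"]
    by (simp add: prod_ennreal)
  also have "\<dots> = ennreal (sqrt (4 * pi * t) ^ DIM('a))"
    unfolding one prod_constant using t by (simp add: ennreal_power)
  also have "sqrt (4 * pi * t) ^ DIM('a) = (4 * pi * t) powr (real DIM('a) / 2)"
    using t by (simp add: powr_half_sqrt[symmetric] powr_realpow[symmetric] powr_powr)
  finally show ?thesis .
qed

lemma nn_integral_lborel_translate:
  fixes f :: "'a::euclidean_space \<Rightarrow> ennreal"
  assumes [measurable]: "f \<in> borel_measurable borel"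
  shows "(\<integral>\<^sup>+y. f (y - x) \<partial>lborel) = (\<integral>\<^sup>+y. f y \<partial>lborel)"
proof -
  have "(\<integral>\<^sup>+y. f y \<partial>lborel) = (\<integral>\<^sup>+y. f y \<partial>distr lborel borel ((+) (- x)))"
    by (simp only: lborel_distr_plus)
  also have "\<dots> = (\<integral>\<^sup>+y. f (y - x) \<partial>lborel)"
    by (subst nn_integral_distr) auto
  finally show ?thesis by simp
qed

section \<open>The Neumann kernel with pole on the boundary\<close>

lemma half_space_borel [measurable]: "half_space \<in> sets borel"
  unfolding half_space_def
  by (intro borel_open open_Collect_less continuous_intros)

text \<open>The tangential factor of the Neumann kernel with pole on the boundary. The prefactor is
  normalised for dimension n, one more than \<open>CARD('m)\<close>, so the total mass carries a
  surplus factor (4 pi t) powr (-1/2).\<close>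

definition bdry_kernel :: "real \<Rightarrow> real ^ 'm::finite \<Rightarrow> real" where
  "bdry_kernel t z = 2 * (4 * pi * t) powr (- (real CARD('m) + 1) / 2) * exp (- (norm z)\<^sup>2 / (4 * t))"

lemma bdry_kernel_nonneg [simp]: "0 \<le> bdry_kernel t z"
  by (simp add: bdry_kernel_def)

lemma borel_measurable_bdry_kernel [measurable]: "bdry_kernel t \<in> borel_measurable borel"
  unfolding bdry_kernel_def[abs_def] by measurable

text \<open>Boundary points are fixed by the reflection, so the two exponentials coincide and give
  the factor 2; Pythagoras splits off the normal direction.\<close>

lemma neumann_kernel_bdry:
  fixes x :: "(real ^ 'm::finite) \<times> real"
  shows "neumann_kernel x (y, 0) t = exp (- (norm (snd x))\<^sup>2 / (4 * t)) * bdry_kernel t (fst x - y)"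
proof -
  have "(norm (x - (y, 0)))\<^sup>2 = (norm (fst x - y))\<^sup>2 + (norm (snd x))\<^sup>2"
    by (cases x) (simp add: norm_Pair)
  then have "exp (- (norm (x - (y, 0)))\<^sup>2 / (4 * t)) =
      exp (- (norm (snd x))\<^sup>2 / (4 * t)) * exp (- (norm (fst x - y))\<^sup>2 / (4 * t))"
    by (simp add: exp_add[symmetric] diff_divide_distrib)
  moreover have "- real DIM((real ^ 'm) \<times> real) / 2 = - (real CARD('m) + 1) / 2"
    by simp
  ultimately show ?thesis
    unfolding neumann_kernel_def reflect_def bdry_kernel_def
    by (simp only: fst_conv snd_conv minus_zero) (simp add: mult_ac)
qed

text \<open>Displays the prefactor as c / A, mass over tangential volume scale, the form required by
  \<open>lorentz_norm_le_of_excess\<close>.\<close>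

lemma bdry_kernel_scale: "2 * (4 * pi * t) powr (- (real CARD('m) + 1) / 2) =
    2 * (4 * pi * t) powr (- 1 / 2) / (4 * pi * t) powr (real CARD('m::finite) / 2)"
proof -
  have "- (real CARD('m) + 1) / 2 = - 1 / 2 - real CARD('m) / 2" by (simp add: field_simps)
  then show ?thesis by (simp only: powr_diff times_divide_eq_right)
qed

lemma bdry_kernel_le:
  fixes z :: "real ^ 'm::finite"
  assumes "0 < t"
  shows "bdry_kernel t z \<le> 2 * (4 * pi * t) powr (- 1 / 2) / (4 * pi * t) powr (real CARD('m) / 2)"
proof -
  have "exp (- (norm z)\<^sup>2 / (4 * t)) \<le> 1" using assms by simp
  then show ?thesis
    unfolding bdry_kernel_def bdry_kernel_scale by (intro mult_left_le) auto
qed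

lemma nn_integral_bdry_kernel:
  assumes t: "0 < t"
  shows "(\<integral>\<^sup>+z. ennreal (bdry_kernel t (z :: real ^ 'm::finite)) \<partial>lborel) =
    ennreal (2 * (4 * pi * t) powr (- 1 / 2))"
proof -
  have "(\<integral>\<^sup>+z. ennreal (bdry_kernel t (z :: real ^ 'm)) \<partial>lborel) =
      ennreal (2 * (4 * pi * t) powr (- 1 / 2) / (4 * pi * t) powr (real CARD('m) / 2)) *
      (\<integral>\<^sup>+z. ennreal (exp (- (norm (z :: real ^ 'm))\<^sup>2 / (4 * t))) \<partial>lborel)"
    unfolding bdry_kernel_def bdry_kernel_scale
    by (subst nn_integral_cmult[symmetric]) (auto intro!: nn_integral_cong simp flip: ennreal_mult)
  then show ?thesis
    using t unfolding nn_integral_gaussian[OF t] by (simp flip: ennreal_mult)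
qed

lemma nn_integral_bdry_kernel_translate:
  fixes x :: "real ^ 'm::finite"
  assumes t: "0 < t"
  shows "(\<integral>\<^sup>+y. ennreal (bdry_kernel t (x - y)) \<partial>lborel) = ennreal (2 * (4 * pi * t) powr (- 1 / 2))"
    "(\<integral>\<^sup>+y. ennreal (bdry_kernel t (y - x)) \<partial>lborel) = ennreal (2 * (4 * pi * t) powr (- 1 / 2))"
proof -
  have "bdry_kernel t (x - y) = bdry_kernel t (y - x)" for y
    by (simp add: bdry_kernel_def norm_minus_commute)
  then show "(\<integral>\<^sup>+y. ennreal (bdry_kernel t (x - y)) \<partial>lborel) = ennreal (2 * (4 * pi * t) powr (- 1 / 2))"
    "(\<integral>\<^sup>+y. ennreal (bdry_kernel t (y - x)) \<partial>lborel) = ennreal (2 * (4 * pi * t) powr (- 1 / 2))"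
    using nn_integral_lborel_translate[of "\<lambda>y. ennreal (bdry_kernel t y)" x] t
    by (simp_all add: nn_integral_bdry_kernel)
qed

lemma nn_integral_bdry_kernel_mult_le:
  fixes x :: "real ^ 'm::finite"
  assumes t: "0 < t" and [measurable]: "h \<in> borel_measurable borel"
  shows "(\<integral>\<^sup>+y. ennreal (bdry_kernel t (x - y)) * h y \<partial>lborel) \<le>
    ennreal (2 * (4 * pi * t) powr (- 1 / 2) / (4 * pi * t) powr (real CARD('m) / 2)) * (\<integral>\<^sup>+y. h y \<partial>lborel)"
  by (subst nn_integral_cmult[symmetric], simp)
     (intro nn_integral_mono mult_right_mono ennreal_leI bdry_kernel_le t, simp)

text \<open>Tonelli and translation invariance: the \<open>L1\<close> counterpart of the supremum
  bound \<open>nn_integral_bdry_kernel_mult_le\<close>.\<close>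

lemma nn_integral_bdry_kernel_convolution:
  assumes t: "0 < t" and [measurable]: "h \<in> borel_measurable borel"
  shows "(\<integral>\<^sup>+x. \<integral>\<^sup>+y. ennreal (bdry_kernel t (x - y :: real ^ 'm::finite)) * h y \<partial>lborel \<partial>lborel) =
    ennreal (2 * (4 * pi * t) powr (- 1 / 2)) * (\<integral>\<^sup>+y. h y \<partial>lborel)"
proof -
  have "(\<integral>\<^sup>+x. \<integral>\<^sup>+y. ennreal (bdry_kernel t (x - y :: real ^ 'm)) * h y \<partial>lborel \<partial>lborel) =
      (\<integral>\<^sup>+y. \<integral>\<^sup>+x. ennreal (bdry_kernel t (x - y)) * h y \<partial>lborel \<partial>lborel)"
    by (rule lborel_pair.Fubini') measurable
  also have "\<dots> = (\<integral>\<^sup>+y. ennreal (2 * (4 * pi * t) powr (- 1 / 2)) * h y \<partial>lborel)"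
    using t by (simp add: nn_integral_multc nn_integral_bdry_kernel_translate)
  finally show ?thesis by (simp add: nn_integral_cmult)
qed

text \<open>Split \<open>\<bar>\<psi>\<bar>\<close> into its excess over \<open>l\<close> and a
  remainder at most \<open>l\<close>; the latter integrates to at most \<open>l\<close> times the
  kernel mass. The absolute value stays inside the integral so that the bound also yields
  integrability.\<close>

lemma nn_integral_neumann_kernel_le:
  fixes x :: "(real ^ 'm::finite) \<times> real"
  assumes t: "0 < t" and [measurable]: "\<psi> \<in> borel_measurable borel" and l: "0 \<le> l"
  shows "(\<integral>\<^sup>+y. ennreal \<bar>neumann_kernel x (y, 0) t * \<psi> y\<bar> \<partial>lborel) \<le>
    ennreal (exp (- (norm (snd x))\<^sup>2 / (4 * t))) *
      ((\<integral>\<^sup>+y. ennreal (bdry_kernel t (fst x - y)) * ennreal (\<bar>\<psi> y\<bar> - l) \<partial>lborel)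
        + ennreal (2 * (4 * pi * t) powr (- 1 / 2) * l))"
proof -
  have "(\<integral>\<^sup>+y. ennreal \<bar>neumann_kernel x (y, 0) t * \<psi> y\<bar> \<partial>lborel) =
      (\<integral>\<^sup>+y. ennreal (exp (- (norm (snd x))\<^sup>2 / (4 * t))) * (ennreal (bdry_kernel t (fst x - y)) * ennreal \<bar>\<psi> y\<bar>) \<partial>lborel)"
    by (intro nn_integral_cong) (simp add: neumann_kernel_bdry abs_mult mult.assoc flip: ennreal_mult)
  also have "\<dots> = ennreal (exp (- (norm (snd x))\<^sup>2 / (4 * t))) * (\<integral>\<^sup>+y. ennreal (bdry_kernel t (fst x - y)) * ennreal \<bar>\<psi> y\<bar> \<partial>lborel)"
    by (rule nn_integral_cmult) measurable
  also have "(\<integral>\<^sup>+y. ennreal (bdry_kernel t (fst x - y)) * ennreal \<bar>\<psi> y\<bar> \<partial>lborel) \<le>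
      (\<integral>\<^sup>+y. ennreal (bdry_kernel t (fst x - y)) * ennreal (\<bar>\<psi> y\<bar> - l) + ennreal (bdry_kernel t (fst x - y)) * ennreal l \<partial>lborel)"
  proof (intro nn_integral_mono)
    fix y
    have "ennreal \<bar>\<psi> y\<bar> \<le> ennreal (\<bar>\<psi> y\<bar> - l) + ennreal l"
      using l by (cases "l \<le> \<bar>\<psi> y\<bar>") (auto simp: ennreal_neg ennreal_leI simp flip: ennreal_plus)
    then show "ennreal (bdry_kernel t (fst x - y)) * ennreal \<bar>\<psi> y\<bar> \<le>
        ennreal (bdry_kernel t (fst x - y)) * ennreal (\<bar>\<psi> y\<bar> - l) + ennreal (bdry_kernel t (fst x - y)) * ennreal l"
      unfolding distrib_left[symmetric] by (intro mult_left_mono) auto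
  qed
  also have "\<dots> = (\<integral>\<^sup>+y. ennreal (bdry_kernel t (fst x - y)) * ennreal (\<bar>\<psi> y\<bar> - l) \<partial>lborel)
      + ennreal (2 * (4 * pi * t) powr (- 1 / 2) * l)"
    using t l by (subst nn_integral_add) (auto simp: nn_integral_multc nn_integral_bdry_kernel_translate ennreal_mult)
  finally show ?thesis by (simp add: mult_left_mono)
qed

section \<open>Truncation estimates for the boundary potential\<close>

lemma bdry_potential_lborel:
  assumes [measurable]: "\<psi> \<in> borel_measurable borel"
  shows "bdry_potential \<psi> x t = (\<integral>y. neumann_kernel x (y, 0) t * \<psi> y \<partial>lborel)"
  unfolding bdry_potential_def neumann_kernel_bdry by (intro integral_completion) measurable

lemma borel_measurable_bdry_potential:
  fixes \<psi> :: "real ^ 'm::finite \<Rightarrow> real"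
  assumes [measurable]: "\<psi> \<in> borel_measurable borel"
  shows "(\<lambda>x. bdry_potential \<psi> x t) \<in> borel_measurable borel"
proof -
  have "(\<lambda>x. \<integral>y. exp (- (norm (snd x))\<^sup>2 / (4 * t)) * bdry_kernel t (fst x - y) * \<psi> y \<partial>lborel)
      \<in> borel_measurable ((borel :: (real ^ 'm) measure) \<Otimes>\<^sub>M (borel :: real measure))"
    by measurable
  then show ?thesis
    by (simp add: bdry_potential_lborel neumann_kernel_bdry borel_prod)
qed

lemma abs_bdry_potential_le:
  fixes x :: "(real ^ 'm::finite) \<times> real"
  assumes t: "0 < t" and \<psi>: "\<psi> \<in> borel_measurable borel" and l: "0 \<le> l"
  shows "ennreal \<bar>bdry_potential \<psi> x t\<bar> \<le>
    ennreal (exp (- (norm (snd x))\<^sup>2 / (4 * t))) *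
      ((\<integral>\<^sup>+y. ennreal (bdry_kernel t (fst x - y)) * ennreal (\<bar>\<psi> y\<bar> - l) \<partial>lborel)
        + ennreal (2 * (4 * pi * t) powr (- 1 / 2) * l))"
proof (cases "integrable lborel (\<lambda>y. neumann_kernel x (y, 0) t * \<psi> y)")
  case True
  from integral_norm_bound_ennreal[OF this] nn_integral_neumann_kernel_le[OF t \<psi> l, of x]
  show ?thesis by (simp add: bdry_potential_lborel[OF \<psi>])
next
  \<comment> \<open>A Bochner integral that does not converge has the value 0, so the bound is
    trivial.\<close>
  case False
  then show ?thesis by (simp add: bdry_potential_lborel[OF \<psi>] not_integrable_integral_eq)
qed

text \<open>Because \<open>e \<le> 1\<close>, subtracting \<open>l\<close> removes the term
  \<open>e * l\<close> while the factor \<open>e\<close> survives on \<open>v\<close>. With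
  \<open>e\<close> the normal Gaussian, this decay makes the excess integrable in the normal
  direction.\<close>

lemma ennreal_excess_le:
  assumes "ennreal \<bar>a\<bar> \<le> ennreal e * (v + ennreal l)" "0 \<le> e" "e \<le> 1" "0 \<le> l"
  shows "ennreal (\<bar>a\<bar> - l) \<le> ennreal e * v"
proof (cases "ennreal e * v" rule: ennreal_cases)
  case (real w)
  have "ennreal \<bar>a\<bar> \<le> ennreal w + ennreal (e * l)"
    using assms real by (simp add: distrib_left ennreal_mult)
  then have "\<bar>a\<bar> \<le> w + e * l"
    using assms real by (simp add: ennreal_le_iff flip: ennreal_plus)
  also have "e * l \<le> l"
    using assms by (simp add: mult_left_le_one_le)
  finally show ?thesis using real by (simp add: ennreal_leI)
qed simp

lemma bdry_potential_excess_le: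
  fixes x :: "(real ^ 'm::finite) \<times> real"
  assumes t: "0 < t" and \<psi>: "\<psi> \<in> borel_measurable borel" and l: "0 \<le> l"
  shows "ennreal (\<bar>bdry_potential \<psi> x t\<bar> - 2 * (4 * pi * t) powr (- 1 / 2) * l) \<le>
    ennreal (exp (- (norm (snd x))\<^sup>2 / (4 * t))) *
      (\<integral>\<^sup>+y. ennreal (bdry_kernel t (fst x - y)) * ennreal (\<bar>\<psi> y\<bar> - l) \<partial>lborel)"
  using assms by (intro ennreal_excess_le abs_bdry_potential_le) auto

text \<open>The normal Gaussian is at most 1 and the tangential kernel is bounded by its supremum.
  The first part serves integrability, the second is the hypothesis \<open>Linf\<close> of
  \<open>lorentz_norm_le_of_excess\<close>.\<close>

lemma bdry_potential_bound:
  fixes x :: "(real ^ 'm::finite) \<times> real"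
  assumes t: "0 < t" and \<psi> [measurable]: "\<psi> \<in> borel_measurable borel" and l: "0 \<le> l"
  shows "(\<integral>\<^sup>+y. ennreal \<bar>neumann_kernel x (y, 0) t * \<psi> y\<bar> \<partial>lborel) \<le>
      ennreal (2 * (4 * pi * t) powr (- 1 / 2) / (4 * pi * t) powr (real CARD('m) / 2)) *
      (\<integral>\<^sup>+y. ennreal (\<bar>\<psi> y\<bar> - l) \<partial>lborel) + ennreal (2 * (4 * pi * t) powr (- 1 / 2) * l)"
    (is ?kernel)
    and "ennreal \<bar>bdry_potential \<psi> x t\<bar> \<le>
      ennreal (2 * (4 * pi * t) powr (- 1 / 2) / (4 * pi * t) powr (real CARD('m) / 2)) *
      (\<integral>\<^sup>+y. ennreal (\<bar>\<psi> y\<bar> - l) \<partial>lborel) + ennreal (2 * (4 * pi * t) powr (- 1 / 2) * l)"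
    (is "_ \<le> ?B")
proof -
  have "ennreal (exp (- (norm (snd x))\<^sup>2 / (4 * t))) \<le> 1"
    using t by (simp add: ennreal_le_1)
  then have "ennreal (exp (- (norm (snd x))\<^sup>2 / (4 * t))) *
      ((\<integral>\<^sup>+y. ennreal (bdry_kernel t (fst x - y)) * ennreal (\<bar>\<psi> y\<bar> - l) \<partial>lborel)
        + ennreal (2 * (4 * pi * t) powr (- 1 / 2) * l)) \<le> 1 * ?B"
    using t by (intro mult_mono add_right_mono nn_integral_bdry_kernel_mult_le) auto
  then show ?kernel "ennreal \<bar>bdry_potential \<psi> x t\<bar> \<le> ?B"
    using nn_integral_neumann_kernel_le[OF t \<psi> l, of x] abs_bdry_potential_le[OF t \<psi> l, of x]
    by auto
qed

text \<open>Integrate the pointwise bound \<open>bdry_potential_excess_le\<close>. On the boundary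
  the normal factor is 1; in the interior it is integrated over the whole line and contributes its
  mass \<open>(4 * pi * t) powr (1 / 2)\<close>.\<close>

lemma bdry_potential_excess_L1:
  fixes \<psi> :: "real ^ 'm::finite \<Rightarrow> real"
  assumes t: "0 < t" and \<psi> [measurable]: "\<psi> \<in> borel_measurable borel" and l: "0 \<le> l"
  defines "c \<equiv> 2 * (4 * pi * t) powr (- 1 / 2)"
  shows "(\<integral>\<^sup>+x. ennreal (\<bar>bdry_potential \<psi> (x, 0) t\<bar> - c * l) \<partial>lborel) \<le>
      ennreal c * (\<integral>\<^sup>+y. ennreal (\<bar>\<psi> y\<bar> - l) \<partial>lborel)"
    and "(\<integral>\<^sup>+x. ennreal (\<bar>bdry_potential \<psi> x t\<bar> - c * l) \<partial>lborel) \<le>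
      ennreal (c * (4 * pi * t) powr (1 / 2)) * (\<integral>\<^sup>+y. ennreal (\<bar>\<psi> y\<bar> - l) \<partial>lborel)"
proof -
  have c: "0 \<le> c" by (simp add: c_def)
  define V where "V x = (\<integral>\<^sup>+y. ennreal (bdry_kernel t (x - y)) * ennreal (\<bar>\<psi> y\<bar> - l) \<partial>lborel)" for x
  have [measurable]: "V \<in> borel_measurable borel"
    unfolding V_def[abs_def] by measurable
  have V: "(\<integral>\<^sup>+x. V x \<partial>lborel) = ennreal c * (\<integral>\<^sup>+y. ennreal (\<bar>\<psi> y\<bar> - l) \<partial>lborel)"
    unfolding V_def c_def using t by (intro nn_integral_bdry_kernel_convolution) auto
  have "(\<integral>\<^sup>+x. ennreal (\<bar>bdry_potential \<psi> (x, 0) t\<bar> - c * l) \<partial>lborel) \<le> (\<integral>\<^sup>+x. V x \<partial>lborel)"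
  proof (rule nn_integral_mono)
    fix x :: "real ^ 'm"
    show "ennreal (\<bar>bdry_potential \<psi> (x, 0) t\<bar> - c * l) \<le> V x"
      using bdry_potential_excess_le[OF t \<psi> l, of "(x, 0)"] by (simp add: V_def c_def)
  qed
  then show "(\<integral>\<^sup>+x. ennreal (\<bar>bdry_potential \<psi> (x, 0) t\<bar> - c * l) \<partial>lborel) \<le>
      ennreal c * (\<integral>\<^sup>+y. ennreal (\<bar>\<psi> y\<bar> - l) \<partial>lborel)"
    unfolding V .
  have "(\<integral>\<^sup>+x. ennreal (\<bar>bdry_potential \<psi> x t\<bar> - c * l) \<partial>lborel) \<le>
      (\<integral>\<^sup>+x. ennreal (exp (- (norm (snd x :: real))\<^sup>2 / (4 * t))) * V (fst x) \<partial>(lborel \<Otimes>\<^sub>M lborel))"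
    unfolding lborel_prod c_def V_def by (intro nn_integral_mono bdry_potential_excess_le t \<psi> l)
  also have "\<dots> = (\<integral>\<^sup>+x. \<integral>\<^sup>+s. ennreal (exp (- (norm (s :: real))\<^sup>2 / (4 * t))) * V x \<partial>lborel \<partial>lborel)"
    by (subst lborel.nn_integral_fst[symmetric]) auto
  also have "\<dots> = (\<integral>\<^sup>+x. ennreal ((4 * pi * t) powr (1 / 2)) * V x \<partial>lborel)"
    using nn_integral_gaussian[OF t, where 'a=real] by (subst nn_integral_multc) auto
  also have "\<dots> = ennreal (c * (4 * pi * t) powr (1 / 2)) * (\<integral>\<^sup>+y. ennreal (\<bar>\<psi> y\<bar> - l) \<partial>lborel)"
    using c by (subst nn_integral_cmult) (auto simp: V ennreal_mult mult_ac)
  finally show "(\<integral>\<^sup>+x. ennreal (\<bar>bdry_potential \<psi> x t\<bar> - c * l) \<partial>lborel) \<le>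
      ennreal (c * (4 * pi * t) powr (1 / 2)) * (\<integral>\<^sup>+y. ennreal (\<bar>\<psi> y\<bar> - l) \<partial>lborel)" .
qed

section \<open>The two smoothing estimates\<close>

theorem lemma4p2:
  fixes n :: nat and d1 d2 :: real and r :: ennreal
  assumes "n \<ge> 3" and "CARD('m::finite) = n - 1"
    and "1 < d1" and "d1 < d2" and "1 \<le> r"
  shows "\<exists>C::real. C > 0 \<and>
    (\<forall>\<psi> \<in> lorentz_space (UNIV :: (real ^ 'm) set) d1 r. \<forall>t::real. t > 0 \<longrightarrow>
      (\<forall>x \<in> closure half_space.
         integrable lebesgue (\<lambda>y'. neumann_kernel x (y', 0) t * \<psi> y')) \<and>
      (\<lambda>x'. bdry_potential \<psi> (x', 0) t) \<in> lorentz_space UNIV d2 r \<and>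
      lorentz_norm UNIV d2 r (\<lambda>x'. bdry_potential \<psi> (x', 0) t)
        \<le> ennreal (C * t powr (- ((real n - 1) / (2 * d1) - (real n - 1) / (2 * d2) + 1 / 2)))
          * lorentz_norm UNIV d1 r \<psi> \<and>
      (\<lambda>x. bdry_potential \<psi> x t) \<in> lorentz_space half_space d2 r \<and>
      lorentz_norm half_space d2 r (\<lambda>x. bdry_potential \<psi> x t)
        \<le> ennreal (C * t powr (- ((real n - 1) / (2 * d1) - real n / (2 * d2) + 1 / 2)))
          * lorentz_norm UNIV d1 r \<psi>)"
proof -
  define e1 where "e1 = - ((real n - 1) / (2 * d1) - (real n - 1) / (2 * d2) + 1 / 2)"
  define e2 where "e2 = - ((real n - 1) / (2 * d1) - real n / (2 * d2) + 1 / 2)"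
  \<comment> \<open>All scales are powers of \<open>4 * pi * t\<close>, so \<open>4 * pi\<close>
    appears with the same exponents as \<open>t\<close>; the maximum covers both estimates. The 2
    comes from the doubled kernel, \<open>d2 / d1\<close> from
    \<open>lorentz_norm_le\<close>.\<close>
  define C where "C = d2 / d1 * 2 * (max ((4 * pi) powr e1) ((4 * pi) powr e2))"
  have card: "real CARD('m) = real n - 1" using assms by simp
  have d: "0 < d1" "d1 < d2" using assms by auto
  have C: "0 < C" using d by (simp add: C_def less_max_iff_disj)
  show ?thesis
  proof (intro exI[of _ C] conjI C ballI allI impI)
    fix \<psi> :: "real ^ 'm \<Rightarrow> real" and t :: real
    assume \<psi>: "\<psi> \<in> lorentz_space UNIV d1 r" and t: "0 < t"
    define c where "c = 2 * (4 * pi * t) powr (- 1 / 2)"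
    define A where "A = (4 * pi * t) powr (real CARD('m) / 2)"
    define k where "k = (4 * pi * t) powr (1 / 2)"
    have pos: "0 < c" "0 < A" "0 < k" using t by (simp_all add: c_def A_def k_def)
    have meas: "\<psi> \<in> borel_measurable (lebesgue_on UNIV)" "\<psi> \<in> borel_measurable lebesgue"
      and fin: "lorentz_norm UNIV d1 r \<psi> < top"
      using \<psi> by (auto simp: lorentz_space_def)
    \<comment> \<open>A Borel representative gives access to product measurability. The kernel
      integrals ignore null sets, so the potentials of \<open>\<psi>\<close> and
      \<open>\<phi>\<close> agree at every point.\<close>
    obtain \<phi> where \<phi> [measurable]: "\<phi> \<in> borel_measurable borel" and ae: "AE x in lborel. \<psi> x = \<phi> x"
      using completion_ex_borel_measurable_real[OF meas(2)] by auto
    from ae have AE: "AE x in lebesgue. \<psi> x = \<phi> x" by (rule AE_completion)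
    have J: "(\<integral>\<^sup>+x\<in>UNIV. ennreal (\<bar>\<psi> x\<bar> - l) \<partial>lebesgue) = (\<integral>\<^sup>+x. ennreal (\<bar>\<phi> x\<bar> - l) \<partial>lborel)" for l
      unfolding nn_integral_completion using ae by (intro nn_integral_cong_AE) auto
    have km: "(\<lambda>y. neumann_kernel x (y, 0) t) \<in> borel_measurable lebesgue" for x :: "(real ^ 'm) \<times> real"
      unfolding neumann_kernel_bdry by (rule measurable_completion) measurable
    have \<phi>l: "\<phi> \<in> borel_measurable lebesgue"
      by (rule measurable_completion) simp
    have pot: "bdry_potential \<psi> x t = bdry_potential \<phi> x t" for x
      unfolding bdry_potential_def
      using AE km[of x] meas(2) \<phi>l by (intro integral_cong_AE borel_measurable_times) auto
    \<comment> \<open>The K-functional at argument 1 is finite, so above some level \<open>l\<close>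
      the excess of \<open>\<phi>\<close> is integrable; this gives absolute convergence at every
      \<open>x\<close>.\<close>
    obtain l where l: "0 \<le> l" and Jfin: "(\<integral>\<^sup>+x. ennreal (\<bar>\<phi> x\<bar> - l) \<partial>lborel) < top"
    proof -
      have rearr_fin: "(\<integral>\<^sup>+u\<in>{0<..<1}. rearr UNIV \<psi> u \<partial>lborel) < top"
        using avg_rearr_finite[OF d(1) assms(5) fin, of 1] mult_avg_rearr[of 1 UNIV \<psi>] by simp
      obtain l where "0 \<le> l" "(\<integral>\<^sup>+x\<in>UNIV. ennreal (\<bar>\<psi> x\<bar> - l) \<partial>lebesgue) + ennreal (l * 1) \<le>
          (\<integral>\<^sup>+u\<in>{0<..<1}. rearr UNIV \<psi> u \<partial>lborel)"
        by (rule nn_integral_rearr_ge[OF _ meas(1) zero_less_one rearr_fin]) auto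
      from this(1) le_less_trans[OF this(2) rearr_fin]
      show ?thesis using that unfolding J by auto
    qed
    show "integrable lebesgue (\<lambda>y. neumann_kernel x (y, 0) t * \<psi> y)" for x
    proof -
      have "integrable lborel (\<lambda>y. neumann_kernel x (y, 0) t * \<phi> y)"
      proof (rule integrableI_bounded)
        show "(\<lambda>y. neumann_kernel x (y, 0) t * \<phi> y) \<in> borel_measurable lborel"
          unfolding neumann_kernel_bdry by measurable
        have "(\<integral>\<^sup>+y. ennreal \<bar>neumann_kernel x (y, 0) t * \<phi> y\<bar> \<partial>lborel) < top"
          using Jfin by (intro le_less_trans[OF bdry_potential_bound(1)[OF t \<phi> l]]) (simp add: ennreal_mult_less_top)
        then show "(\<integral>\<^sup>+y. ennreal (norm (neumann_kernel x (y, 0) t * \<phi> y)) \<partial>lborel) < \<infinity>"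
          by simp
      qed
      then have "integrable lebesgue (\<lambda>y. neumann_kernel x (y, 0) t * \<phi> y)"
        unfolding neumann_kernel_bdry by (subst integrable_completion) measurable
      then show ?thesis
        using AE km[of x] meas(2) \<phi>l
        by (subst integrable_cong_AE[where g="\<lambda>y. neumann_kernel x (y, 0) t * \<phi> y"]) (auto intro!: borel_measurable_times)
    qed
    have C_ge: "d2 / d1 * (2 * ((4 * pi) powr e * s)) \<le> C * s" if "e = e1 \<or> e = e2" "0 \<le> s" for e s
    proof -
      have "d2 / d1 * 2 * (4 * pi) powr e \<le> C"
        unfolding C_def using that d by (intro mult_left_mono) auto
      then show ?thesis
        using mult_right_mono[of "d2 / d1 * 2 * (4 * pi) powr e" C s] that by (simp add: mult_ac)
    qed
    have m1: "(\<lambda>x'. bdry_potential \<phi> (x', 0) t) \<in> borel_measurable (lebesgue_on UNIV)"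
      using measurable_compose[OF _ borel_measurable_bdry_potential[OF \<phi>], of "\<lambda>x'. (x', 0)" borel t]
      by (intro measurable_restrict_space1 measurable_completion) simp
    have m2: "(\<lambda>x. bdry_potential \<phi> x t) \<in> borel_measurable (lebesgue_on half_space)"
      using borel_measurable_bdry_potential[OF \<phi>, of t]
      by (intro measurable_restrict_space1 measurable_completion) simp
    have "lorentz_norm UNIV d2 r (\<lambda>x'. bdry_potential \<phi> (x', 0) t) \<le>
        ennreal (d2 / d1 * (c * 1 powr (1 / d2) * A powr (1 / d2 - 1 / d1))) * lorentz_norm UNIV d1 r \<psi>"
    \<comment> \<open>On the boundary there is no normal direction to integrate, hence
      \<open>k\<close> is 1.\<close>
    proof (rule lorentz_norm_le_of_excess[OF d assms(5) pos(1) _ pos(2) _ meas(1) _ m1])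
      show "(\<integral>\<^sup>+x\<in>UNIV. ennreal (\<bar>bdry_potential \<phi> (x, 0) t\<bar> - c * l) \<partial>lebesgue) \<le>
          ennreal (c * 1) * (\<integral>\<^sup>+x\<in>UNIV. ennreal (\<bar>\<psi> x\<bar> - l) \<partial>lebesgue)" if "0 \<le> l" for l
        unfolding J using bdry_potential_excess_L1(1)[OF t \<phi> that]
        by (simp add: nn_integral_completion c_def)
      show "ennreal \<bar>bdry_potential \<phi> (x, 0) t\<bar> \<le>
          ennreal (c / A) * (\<integral>\<^sup>+x\<in>UNIV. ennreal (\<bar>\<psi> x\<bar> - l) \<partial>lebesgue) + ennreal (c * l)" if "0 \<le> l" for l x
        unfolding J c_def A_def by (rule bdry_potential_bound(2)[OF t \<phi> that])
    qed auto
    also have "c * 1 powr (1 / d2) * A powr (1 / d2 - 1 / d1) = 2 * ((4 * pi) powr e1 * t powr e1)"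
    proof -
      \<comment> \<open>The exponent -1/2 comes from \<open>c\<close>, the rest from the power of
        \<open>A\<close>.\<close>
      have "- 1 / 2 + real CARD('m) / 2 * (1 / d2 - 1 / d1) = e1"
        using d by (simp add: e1_def card field_simps)
      then show ?thesis
        using t by (simp add: c_def A_def powr_powr powr_mult[symmetric] powr_add[symmetric])
    qed
    also have "ennreal (d2 / d1 * (2 * ((4 * pi) powr e1 * t powr e1))) * lorentz_norm UNIV d1 r \<psi> \<le>
        ennreal (C * t powr e1) * lorentz_norm UNIV d1 r \<psi>"
      by (intro mult_right_mono ennreal_leI C_ge) auto
    finally have bdry: "lorentz_norm UNIV d2 r (\<lambda>x'. bdry_potential \<phi> (x', 0) t) \<le>
        ennreal (C * t powr e1) * lorentz_norm UNIV d1 r \<psi>" .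
    have "lorentz_norm half_space d2 r (\<lambda>x. bdry_potential \<phi> x t) \<le>
        ennreal (d2 / d1 * (c * k powr (1 / d2) * A powr (1 / d2 - 1 / d1))) * lorentz_norm UNIV d1 r \<psi>"
    proof (rule lorentz_norm_le_of_excess[OF d assms(5) pos(1) pos(3) pos(2) _ meas(1) _ m2])
      show "(\<integral>\<^sup>+x\<in>half_space. ennreal (\<bar>bdry_potential \<phi> x t\<bar> - c * l) \<partial>lebesgue) \<le>
          ennreal (c * k) * (\<integral>\<^sup>+x\<in>UNIV. ennreal (\<bar>\<psi> x\<bar> - l) \<partial>lebesgue)" if "0 \<le> l" for l
      proof -
        \<comment> \<open>Enlarging the half-space to the whole space allows the product form of the
          Gaussian bound.\<close>
        have "(\<integral>\<^sup>+x\<in>half_space. ennreal (\<bar>bdry_potential \<phi> x t\<bar> - c * l) \<partial>lebesgue) \<le>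
            (\<integral>\<^sup>+x. ennreal (\<bar>bdry_potential \<phi> x t\<bar> - c * l) \<partial>lborel)"
          unfolding nn_integral_completion by (intro nn_integral_mono) (auto split: split_indicator)
        also have "\<dots> \<le> ennreal (c * k) * (\<integral>\<^sup>+x\<in>UNIV. ennreal (\<bar>\<psi> x\<bar> - l) \<partial>lebesgue)"
          unfolding J c_def k_def by (rule bdry_potential_excess_L1(2)[OF t \<phi> that])
        finally show ?thesis .
      qed
      show "ennreal \<bar>bdry_potential \<phi> x t\<bar> \<le>
          ennreal (c / A) * (\<integral>\<^sup>+x\<in>UNIV. ennreal (\<bar>\<psi> x\<bar> - l) \<partial>lebesgue) + ennreal (c * l)" if "0 \<le> l" for l x
        unfolding J c_def A_def by (rule bdry_potential_bound(2)[OF t \<phi> that])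
    qed auto
    also have "c * k powr (1 / d2) * A powr (1 / d2 - 1 / d1) = 2 * ((4 * pi) powr e2 * t powr e2)"
    proof -
      \<comment> \<open>Compared with the boundary, \<open>k powr (1 / d2)\<close> adds 1/(2 d2),
        which replaces n - 1 by n over \<open>2 * d2\<close>.\<close>
      have "1 / (2 * d2) + real CARD('m) * (1 / d2 - 1 / d1) / 2 - 1 / 2 = e2"
        using d by (simp add: e2_def card field_simps)
      then show ?thesis
        using t by (simp add: c_def A_def k_def powr_powr powr_mult[symmetric] powr_add[symmetric])
    qed
    also have "ennreal (d2 / d1 * (2 * ((4 * pi) powr e2 * t powr e2))) * lorentz_norm UNIV d1 r \<psi> \<le>
        ennreal (C * t powr e2) * lorentz_norm UNIV d1 r \<psi>"
      by (intro mult_right_mono ennreal_leI C_ge) auto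
    finally have half: "lorentz_norm half_space d2 r (\<lambda>x. bdry_potential \<phi> x t) \<le>
        ennreal (C * t powr e2) * lorentz_norm UNIV d1 r \<psi>" .
    show "lorentz_norm UNIV d2 r (\<lambda>x'. bdry_potential \<psi> (x', 0) t)
        \<le> ennreal (C * t powr (- ((real n - 1) / (2 * d1) - (real n - 1) / (2 * d2) + 1 / 2)))
          * lorentz_norm UNIV d1 r \<psi>"
      using bdry unfolding pot e1_def .
    show "lorentz_norm half_space d2 r (\<lambda>x. bdry_potential \<psi> x t)
        \<le> ennreal (C * t powr (- ((real n - 1) / (2 * d1) - real n / (2 * d2) + 1 / 2)))
          * lorentz_norm UNIV d1 r \<psi>"
      using half unfolding pot e2_def .
    show "(\<lambda>x'. bdry_potential \<psi> (x', 0) t) \<in> lorentz_space UNIV d2 r"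
      unfolding lorentz_space_def pot using m1 le_less_trans[OF bdry] fin
      by (simp add: ennreal_mult_less_top)
    show "(\<lambda>x. bdry_potential \<psi> x t) \<in> lorentz_space half_space d2 r"
      unfolding lorentz_space_def pot using m2 le_less_trans[OF half] fin
      by (simp add: ennreal_mult_less_top)
  qed
qed

end
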